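(* Let $\mathcal{A}(\underline X,\underline Y)=A+X_1B_1+\cdots+X_nB_n+Y_1C_1+\cdots+Y_mC_m$ be a strictly feasible $k$-dimensional linear matrix polynomial, and let $S=\{x\in\mathbb{R}^n\mid\exists y\in\mathbb{R}^m:\ \mathcal{A}(x,y)\succeq 0\}$. Then $\mathrm{QM}(\mathcal{A})$ contains only polynomials that are nonnegative on $S$, and the set of points in $\mathbb{R}^n$ where all elements of $\mathrm{QM}(\mathcal{A})$ are nonnegative is precisely $\overline{S}$. If $S$ is bounded, then $\mathrm{QM}(\mathcal{A})$ is archimedean, and thus contains all polynomials $p\in\mathbb{R}[\underline X]$ with $p>0$ on $\overline{S}$.
   Context: Here $A,B_1,\ldots,B_n,C_1,\ldots,C_m$ are real symmetric $k\times k$ matrices, $\underline X=(X_1,\ldots,X_n)$, $\underline Y=(Y_1,\ldots,Y_m)$; $\mathcal{A}$ is strictly feasible if $\mathcal{A}(x,y)$ is positive definite for some $(x,y)\in\mathbb{R}^{n+m}$; $\succeq 0$ means positive semidefinite. Put $\mathcal{A}'(\underline X)=\mathcal{A}(\underline X,0)$. Define $$\mathrm{QM}(\mathcal{A})=\Big\{\sum_j q_j^t\mathcal{A}'(\underline X)q_j+\sigma\ \Big|\ q_j\in\mathbb{R}[\underline X]^k,\ \sum_j q_j^tC_iq_j=0\text{ for }i=1,\ldots,m,\ \sigma\in\sum\mathbb{R}[\underline X]^2\Big\},$$ where the sums over $j$ are finite and $\sum\mathbb{R}[\underline X]^2$ is the set of finite sums of squares of polynomials. This is a quadratic module in $\mathbb{R}[\underline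 X]$ (it contains $1$, is closed under addition, and under multiplication by squares of polynomials). A quadratic module $Q\subseteq\mathbb{R}[\underline X]$ is archimedean if for every $f\in\mathbb{R}[\underline X]$ there is $N\in\mathbb{N}$ with $N-f\in Q$. *)

theory Defs
  imports "HOL-Analysis.Analysis" "HOL-Library.Poly_Mapping"
begin

subsection \<open>Real polynomials in finitely many variables\<close>

text \<open>
  Polynomials are finitely supported maps from exponent vectors to coefficients. The ring
  structure, with convolution as multiplication, comes from the Poly_Mapping library.
\<close>

type_synonym 'n rpoly = "('n \<Rightarrow>\<^sub>0 nat) \<Rightarrow>\<^sub>0 real"

definition pconst :: "real \<Rightarrow> 'n rpoly"
  where "pconst c = Poly_Mapping.single 0 c"

definition pvar :: "'n \<Rightarrow> 'n rpoly"
  where "pvar i = Poly_Mapping.single (Poly_Mapping.single i 1) 1"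

definition peval :: "'n::finite rpoly \<Rightarrow> real ^ 'n \<Rightarrow> real"
  where "peval p x =
    (\<Sum>t\<in>Poly_Mapping.keys p.
       Poly_Mapping.lookup p t * (\<Prod>i\<in>UNIV. (x $ i) ^ Poly_Mapping.lookup t i))"

definition sums_of_squares :: "'n rpoly set"
  where "sums_of_squares = {s. \<exists>(N::nat) g. s = (\<Sum>j<N. (g j)\<^sup>2)}"

definition quadratic_module :: "'n rpoly set \<Rightarrow> bool"
  where "quadratic_module Q \<longleftrightarrow>
    1 \<in> Q \<and> (\<forall>f\<in>Q. \<forall>g\<in>Q. f + g \<in> Q) \<and> (\<forall>f\<in>Q. \<forall>h. h\<^sup>2 * f \<in> Q)"

definition archimedean_qm :: "'n rpoly set \<Rightarrow> bool"
  where "archimedean_qm Q \<longleftrightarrow>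
    quadratic_module Q \<and> (\<forall>f. \<exists>N::nat. of_nat N - f \<in> Q)"


subsection \<open>Linear matrix polynomials\<close>

definition symmetric_matrix :: "'a ^ 'k ^ 'k \<Rightarrow> bool"
  where "symmetric_matrix M \<longleftrightarrow> transpose M = M"

definition pos_semidef :: "real ^ 'k ^ 'k \<Rightarrow> bool"
  where "pos_semidef M \<longleftrightarrow> symmetric_matrix M \<and> (\<forall>v. 0 \<le> v \<bullet> (M *v v))"

definition pos_def :: "real ^ 'k ^ 'k \<Rightarrow> bool"
  where "pos_def M \<longleftrightarrow> symmetric_matrix M \<and> (\<forall>v. v \<noteq> 0 \<longrightarrow> 0 < v \<bullet> (M *v v))"

text \<open>
  The number \<open>m\<close> of \<open>Y\<close>-variables is a natural number, so that \<open>m = 0\<close> is included. The family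
  \<open>C\<close> and the point \<open>y\<close> are functions on the naturals, of which only the values at \<open>0, \<dots>, m - 1\<close>
  are used.
\<close>

definition lin_matrix ::
  "real ^ 'k ^ 'k \<Rightarrow> ('n::finite \<Rightarrow> real ^ 'k ^ 'k) \<Rightarrow> nat \<Rightarrow> (nat \<Rightarrow> real ^ 'k ^ 'k) \<Rightarrow>
   real ^ 'n \<Rightarrow> (nat \<Rightarrow> real) \<Rightarrow> real ^ 'k ^ 'k"
  where "lin_matrix A B m C x y =
    A + (\<Sum>i\<in>UNIV. (x $ i) *\<^sub>R B i) + (\<Sum>j<m. y j *\<^sub>R C j)"

definition strictly_feasible ::
  "real ^ 'k ^ 'k \<Rightarrow> ('n::finite \<Rightarrow> real ^ 'k ^ 'k) \<Rightarrow> nat \<Rightarrow> (nat \<Rightarrow> real ^ 'k ^ 'k) \<Rightarrow> bool"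
  where "strictly_feasible A B m C \<longleftrightarrow> (\<exists>x y. pos_def (lin_matrix A B m C x y))"

definition proj_spectrahedron ::
  "real ^ 'k ^ 'k \<Rightarrow> ('n::finite \<Rightarrow> real ^ 'k ^ 'k) \<Rightarrow> nat \<Rightarrow> (nat \<Rightarrow> real ^ 'k ^ 'k) \<Rightarrow>
   (real ^ 'n) set"
  where "proj_spectrahedron A B m C = {x. \<exists>y. pos_semidef (lin_matrix A B m C x y)}"


subsection \<open>The associated quadratic module\<close>

definition const_matrix :: "real ^ 'k ^ 'k \<Rightarrow> 'n rpoly ^ 'k ^ 'k"
  where "const_matrix M = (\<chi> r s. pconst (M $ r $ s))"

text \<open>The matrix \<open>\<A>'(X) = \<A>(X, 0)\<close>, with polynomial entries.\<close>

definition lin_poly_matrix ::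
  "real ^ 'k ^ 'k \<Rightarrow> ('n::finite \<Rightarrow> real ^ 'k ^ 'k) \<Rightarrow> 'n rpoly ^ 'k ^ 'k"
  where "lin_poly_matrix A B =
    const_matrix A + (\<Sum>i\<in>UNIV. \<chi> r s. pvar i * const_matrix (B i) $ r $ s)"

text \<open>The value \<open>q\<^sup>t M q\<close>.\<close>

definition qform :: "'a::comm_semiring_1 ^ 'k ^ 'k \<Rightarrow> 'a ^ 'k \<Rightarrow> 'a"
  where "qform M q = (\<Sum>r\<in>UNIV. q $ r * (M *v q) $ r)"

definition QM ::
  "real ^ 'k ^ 'k \<Rightarrow> ('n::finite \<Rightarrow> real ^ 'k ^ 'k) \<Rightarrow> nat \<Rightarrow> (nat \<Rightarrow> real ^ 'k ^ 'k) \<Rightarrow>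
   'n rpoly set"
  where "QM A B m C =
    {(\<Sum>j<N. qform (lin_poly_matrix A B) (q j)) + \<sigma> | (N::nat) (q :: nat \<Rightarrow> 'n rpoly ^ 'k) \<sigma>.
       (\<forall>i<m. (\<Sum>j<N. qform (const_matrix (C i)) (q j)) = 0) \<and> \<sigma> \<in> sums_of_squares}"

end

theory Submission
  imports Defs
begin

text \<open>
  Nonnegativity on \<open>S\<close> is direct evaluation. Conversely, by conic duality, where strict feasibility
  provides the interior point, an affine polynomial \<open>\<ell>\<close> that is nonnegative on \<open>S\<close> has the form
  \<open>\<ell>(x) = tr (W \<A>(x, y)) + s\<close> with \<open>W\<close> positive semidefinite and \<open>s \<ge> 0\<close>. Hence \<open>tr (W C\<^sub>i) = 0\<close>, and
  writing \<open>W\<close> as a sum of matrices \<open>w w\<^sup>t\<close> shows \<open>\<ell> \<in> QM(\<A>)\<close> with constant vectors \<open>q\<^sub>j\<close>. Separating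
  a point from the closed convex set \<open>closure S\<close> by such an \<open>\<ell>\<close> identifies the nonnegativity set. If \<open>S\<close> is
  bounded, then \<open>R - X\<^sub>i\<close> and \<open>R + X\<^sub>i\<close> are in \<open>QM(\<A>)\<close> for large \<open>R\<close>, which makes \<open>QM(\<A>)\<close> archimedean.

  For the Positivstellensatz for an archimedean quadratic module \<open>Q\<close>, a maximal proper quadratic
  module \<open>M\<close> containing \<open>Q\<close> satisfies \<open>M \<union> - M = \<real>[X]\<close>, and therefore consists of polynomials that are
  nonnegative at some point. So if \<open>p > 0\<close> wherever \<open>Q\<close> is nonnegative, then \<open>Q - \<Sum> p\<close> (with \<open>\<Sum>\<close> the sums of
  squares) contains \<open>- 1\<close>, that is, \<open>\<sigma> p - 1 \<in> Q\<close> for some sum of squares \<open>\<sigma>\<close>, and an elementary descent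
  on \<open>r\<close> with \<open>p + r \<in> Q\<close> removes \<open>\<sigma>\<close>.
\<close>

subsection \<open>Evaluation of polynomials\<close>

lemma pconst_0 [simp]: "pconst 0 = 0"
  by (simp add: pconst_def)

lemma pconst_1 [simp]: "pconst 1 = 1"
  by (simp add: pconst_def)

lemma pconst_add: "pconst (a + b) = pconst a + pconst b"
  by (simp add: pconst_def single_add)

lemma pconst_minus: "pconst (- a) = - pconst a"
  by (simp add: pconst_def single_uminus)

lemma pconst_diff: "pconst (a - b) = pconst a - pconst b"
  by (simp add: pconst_def single_diff)

lemma pconst_mult: "pconst (a * b) = pconst a * pconst b"
  by (simp add: pconst_def mult_single)

lemma pconst_power: "pconst (a ^ n) = pconst a ^ n"
  by (induction n) (simp_all add: pconst_mult)

lemma pconst_sum: "pconst (sum f I) = (\<Sum>i\<in>I. pconst (f i))"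
  by (induction I rule: infinite_finite_induct) (simp_all add: pconst_add)

lemma pconst_of_nat: "pconst (of_nat n) = of_nat n"
  by (induction n) (simp_all add: pconst_add)

lemma pconst_numeral: "pconst (numeral n) = numeral n"
  using pconst_of_nat[of "numeral n"] by simp

lemmas pconst_hom = pconst_add pconst_minus pconst_diff pconst_mult pconst_power pconst_numeral

text \<open>The supports of \<open>p\<close>, \<open>q\<close> and \<open>p + q\<close> differ;
  padding with zero terms lets all three be summed over one index set.\<close>

lemma peval_superset:
  assumes "finite T" "Poly_Mapping.keys p \<subseteq> T"
  shows "peval p x =
    (\<Sum>t\<in>T. Poly_Mapping.lookup p t * (\<Prod>i\<in>UNIV. (x $ i) ^ Poly_Mapping.lookup t i))"
  unfolding peval_def using assms
  by (intro sum.mono_neutral_left) (auto simp: in_keys_iff)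

lemma peval_add [simp]: "peval (p + q) x = peval p x + peval q x"
proof -
  let ?T = "Poly_Mapping.keys p \<union> Poly_Mapping.keys q"
  have "Poly_Mapping.keys (p + q) \<subseteq> ?T"
    by (rule keys_add)
  then show ?thesis
    by (simp add: peval_superset[of ?T] lookup_add distrib_right sum.distrib)
qed

lemma peval_single:
  "peval (Poly_Mapping.single t c) x = c * (\<Prod>i\<in>UNIV. (x $ i) ^ Poly_Mapping.lookup t i)"
  by (subst peval_superset[of "{t}"]) (auto simp: lookup_single)

lemma peval_0 [simp]: "peval 0 x = 0"
  by (simp add: peval_def)

lemma peval_pconst [simp]: "peval (pconst c) x = c"
  by (simp add: pconst_def peval_single)

lemma peval_1 [simp]: "peval 1 x = 1"
  using peval_pconst[of 1] by simp

lemma peval_pvar [simp]: "peval (pvar i) x = x $ i"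
proof -
  have "(\<Prod>j\<in>UNIV. (x $ j) ^ Poly_Mapping.lookup (Poly_Mapping.single i 1) j)
      = (\<Prod>j\<in>UNIV. if j = i then x $ j else 1)"
    by (rule prod.cong) (auto simp: lookup_single when_def)
  then show ?thesis
    by (simp add: pvar_def peval_single)
qed

lemma peval_uminus [simp]: "peval (- p) x = - peval p x"
  using peval_add[of "- p" p x] by simp

lemma peval_diff [simp]: "peval (p - q) x = peval p x - peval q x"
  using peval_add[of p "- q" x] by simp

lemma peval_single_mult_single:
  "peval (Poly_Mapping.single s a * Poly_Mapping.single t b) x
    = peval (Poly_Mapping.single s a) x * peval (Poly_Mapping.single t b) x"
  by (simp add: mult_single peval_single lookup_add power_add prod.distrib)

text \<open>Updating at a fresh key is the same as adding a monomial, so additive maps can be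
  checked term by term.\<close>

lemma poly_mapping_single_add_induct [case_names zero single_add]:
  fixes p :: "'a \<Rightarrow>\<^sub>0 'b::comm_monoid_add"
  assumes "P 0" "\<And>t c q. P q \<Longrightarrow> P (Poly_Mapping.single t c + q)"
  shows "P p"
proof (induction p rule: update_induct)
  case const
  show ?case by (rule assms(1))
next
  case (update f a b)
  have "Poly_Mapping.update a b f = Poly_Mapping.single a b + f"
    using update(1)
    by (intro poly_mapping_eqI) (auto simp: lookup_update lookup_add lookup_single in_keys_iff)
  then show ?case using assms(2) update(3) by simp
qed

lemma peval_mult [simp]: "peval (p * q) x = peval p x * peval q x"
proof -
  have "peval (Poly_Mapping.single s a * q) x = peval (Poly_Mapping.single s a) x * peval q x" for s a
    by (induction q rule: poly_mapping_single_add_induct)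
      (simp_all add: distrib_left peval_single_mult_single)
  then show ?thesis
    by (induction p rule: poly_mapping_single_add_induct) (simp_all add: distrib_right)
qed

lemma peval_power [simp]: "peval (p ^ k) x = peval p x ^ k"
  by (induction k) simp_all

lemma peval_sum [simp]: "peval (sum f I) x = (\<Sum>i\<in>I. peval (f i) x)"
  by (induction I rule: infinite_finite_induct) simp_all

lemma continuous_on_peval: "continuous_on X (peval p)"
  unfolding peval_def by (intro continuous_intros)

text \<open>Constants and variables generate the ring: powers of a variable come first, then
  monomials, then their combinations. Later it reduces approximation by a point value and
  boundedness modulo \<open>Q\<close> to generators.\<close>

lemma rpoly_induct [case_names pconst pvar add mult]:
  fixes p :: "'n rpoly"
  assumes const: "\<And>c. P (pconst c)" and var: "\<And>i. P (pvar i)"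
    and add: "\<And>p q. P p \<Longrightarrow> P q \<Longrightarrow> P (p + q)"
    and mult: "\<And>p q. P p \<Longrightarrow> P q \<Longrightarrow> P (p * q)"
  shows "P p"
proof -
  have one: "P 1" and P_0: "P 0"
    using const[of 1] const[of 0] by simp_all
  have pow: "P (Poly_Mapping.single (Poly_Mapping.single i k) 1)" for i and k :: nat
  proof (induction k)
    case 0
    show ?case using one by simp
  next
    case (Suc k)
    have "Poly_Mapping.single (Poly_Mapping.single i (Suc k)) (1::real)
        = pvar i * Poly_Mapping.single (Poly_Mapping.single i k) 1"
      by (simp add: pvar_def mult_single flip: single_add)
    then show ?case using mult[OF var Suc] by simp
  qed
  have mono: "P (Poly_Mapping.single t 1)" for t
  proof (induction t rule: poly_mapping_single_add_induct)
    case zero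
    show ?case using one by simp
  next
    case (single_add i k t)
    then show ?case
      using mult[OF pow, of "Poly_Mapping.single t 1" i k] by (simp add: mult_single)
  qed
  show ?thesis
  proof (induction p rule: poly_mapping_single_add_induct)
    case zero
    show ?case by (rule P_0)
  next
    case (single_add t c q)
    have "Poly_Mapping.single t c = pconst c * Poly_Mapping.single t 1"
      by (simp add: pconst_def mult_single)
    then show ?case using mult[OF const mono, of c t] single_add add by simp
  qed
qed

subsection \<open>Sums of squares and quadratic modules\<close>

text \<open>Concatenation of two finite families; it gives closure under addition for
  \<open>sums_of_squares\<close> and for \<open>QM\<close>.\<close>

lemma sum_lessThan_append:
  fixes N K :: nat
  shows "(\<Sum>j<N. f (g j)) + (\<Sum>j<K. f (h j)) = (\<Sum>j<N + K. f (if j < N then g j else h (j - N)))"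
  by (induction K) (simp_all add: add.assoc[symmetric])

lemma sosI: "(\<Sum>j<N::nat. (g j)\<^sup>2) \<in> sums_of_squares"
  unfolding sums_of_squares_def by blast

lemma sos_0 [simp]: "0 \<in> sums_of_squares"
  using sosI[of _ 0] by simp

lemma sos_square [simp]: "g\<^sup>2 \<in> sums_of_squares"
  using sosI[of "\<lambda>_. g" 1] by simp

lemma sos_1 [simp]: "1 \<in> sums_of_squares"
  using sos_square[of 1] by simp

lemma sos_add:
  assumes "s \<in> sums_of_squares" "t \<in> sums_of_squares"
  shows "s + t \<in> sums_of_squares"
proof -
  obtain N :: nat and g and K :: nat and h
    where "s = (\<Sum>j<N. (g j)\<^sup>2)" "t = (\<Sum>j<K. (h j)\<^sup>2)"
    using assms by (auto simp: sums_of_squares_def)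
  then have "s + t = (\<Sum>j<N + K. (if j < N then g j else h (j - N))\<^sup>2)"
    using sum_lessThan_append[of "\<lambda>x. x\<^sup>2" g N h K] by simp
  then show ?thesis using sosI by simp
qed

lemma sos_square_mult:
  assumes "s \<in> sums_of_squares"
  shows "h\<^sup>2 * s \<in> sums_of_squares"
proof -
  obtain N :: nat and g where "s = (\<Sum>j<N. (g j)\<^sup>2)"
    using assms by (auto simp: sums_of_squares_def)
  then have "h\<^sup>2 * s = (\<Sum>j<N. (h * g j)\<^sup>2)"
    by (simp add: sum_distrib_left power_mult_distrib)
  then show ?thesis using sosI by simp
qed

lemma sos_pconst: "0 \<le> c \<Longrightarrow> pconst c \<in> sums_of_squares"
  using sos_square[of "pconst (sqrt c)"] by (simp flip: pconst_power)

lemma peval_sos_nonneg: "s \<in> sums_of_squares \<Longrightarrow> 0 \<le> peval s x"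
  by (auto simp: sums_of_squares_def intro!: sum_nonneg)

context
  fixes Q :: "'n rpoly set"
  assumes Q: "quadratic_module Q"
begin

lemma qm_one: "1 \<in> Q"
  and qm_add: "f \<in> Q \<Longrightarrow> g \<in> Q \<Longrightarrow> f + g \<in> Q"
  and qm_square_mult: "f \<in> Q \<Longrightarrow> h\<^sup>2 * f \<in> Q"
  using Q by (auto simp: quadratic_module_def)

lemma qm_square: "h\<^sup>2 \<in> Q"
  using qm_square_mult[OF qm_one] by simp

lemma qm_pconst: "0 \<le> c \<Longrightarrow> pconst c \<in> Q"
  using qm_square[of "pconst (sqrt c)"] by (simp flip: pconst_power)

lemma qm_zero: "0 \<in> Q"
  using qm_pconst[of 0] by simp

lemma qm_scale: "0 \<le> c \<Longrightarrow> f \<in> Q \<Longrightarrow> pconst c * f \<in> Q"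
  using qm_square_mult[of f "pconst (sqrt c)"] by (simp flip: pconst_power)

text \<open>A positive constant has an inverse that is itself a square, so denominators can be
  cleared before proving membership.\<close>

lemma qm_unscale:
  assumes "0 < c" "pconst c * f \<in> Q"
  shows "f \<in> Q"
proof -
  have "pconst (1 / c) * (pconst c * f) = f"
    using assms(1) by (simp flip: mult.assoc pconst_mult)
  then show ?thesis using qm_scale[of "1 / c" "pconst c * f"] assms by simp
qed

lemma qm_sos_mult:
  assumes "s \<in> sums_of_squares" "f \<in> Q"
  shows "s * f \<in> Q"
proof -
  obtain N :: nat and g where s: "s = (\<Sum>j<N. (g j)\<^sup>2)"
    using assms(1) by (auto simp: sums_of_squares_def)
  have "(\<Sum>j<n. (g j)\<^sup>2) * f \<in> Q" for n :: nat
    by (induction n) (auto simp: qm_zero distrib_right intro!: qm_add qm_square_mult assms(2))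
  then show ?thesis unfolding s .
qed

lemma qm_sos: "s \<in> sums_of_squares \<Longrightarrow> s \<in> Q"
  using qm_sos_mult[OF _ qm_one] by simp

lemma qm_mono_const:
  assumes "pconst c - f \<in> Q" "c \<le> d"
  shows "pconst d - f \<in> Q"
  using qm_add[OF assms(1) qm_pconst[of "d - c"]] assms(2) by (simp add: pconst_diff)

text \<open>A quadratic module need not contain the product \<open>(c - f) * (c + f)\<close> of two
  of its elements. Up to the factor \<open>2 * c\<close>, this product is a sum of the two elements
  with squares as weights.\<close>

lemma qm_square_bound:
  assumes c: "0 < c" and f: "pconst c - f \<in> Q" "pconst c + f \<in> Q"
  shows "pconst (c\<^sup>2) - f\<^sup>2 \<in> Q"
proof (rule qm_unscale)
  show "0 < 2 * c" using c by simp
  have "pconst (2 * c) * (pconst (c\<^sup>2) - f\<^sup>2)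
      = (pconst c + f)\<^sup>2 * (pconst c - f) + (pconst c - f)\<^sup>2 * (pconst c + f)"
    by (simp add: pconst_hom power2_eq_square algebra_simps)
  then show "pconst (2 * c) * (pconst (c\<^sup>2) - f\<^sup>2) \<in> Q"
    using f by (auto intro!: qm_add qm_square_mult)
qed

text \<open>The support of \<open>Q\<close> (the elements \<open>a\<close> with both signs in
  \<open>Q\<close>) is an ideal, because \<open>4 * r\<close> is the difference of the squares of
  \<open>r + 1\<close> and \<open>r - 1\<close>.\<close>

lemma qm_support_mult:
  assumes "a \<in> Q" "- a \<in> Q"
  shows "r * a \<in> Q"
proof (rule qm_unscale)
  show "(0::real) < 4" by simp
  have "pconst 4 * (r * a) = (r + 1)\<^sup>2 * a + (r - 1)\<^sup>2 * (- a)"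
    by (simp add: pconst_hom power2_eq_square algebra_simps)
  then show "pconst 4 * (r * a) \<in> Q"
    using assms by (auto intro!: qm_add qm_square_mult simp del: mult_minus_right)
qed

lemma qm_pconst_nonneg:
  assumes "- 1 \<notin> Q" "pconst c \<in> Q"
  shows "0 \<le> c"
proof (rule ccontr)
  assume "\<not> 0 \<le> c"
  then have "pconst (- 1 / c) * pconst c \<in> Q"
    by (intro qm_scale assms(2)) (simp add: field_simps)
  also have "pconst (- 1 / c) * pconst c = - 1"
    using \<open>\<not> 0 \<le> c\<close> pconst_minus[of 1] by (simp flip: pconst_mult)
  finally show False using assms(1) by simp
qed

section \<open>Adjoining an element, and maximal proper quadratic modules\<close>

lemma qm_adjoin_subset: "Q \<subseteq> {s + t * a |s t. s \<in> Q \<and> t \<in> sums_of_squares}"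
proof
  fix s assume "s \<in> Q"
  then have "s = s + 0 * a \<and> s \<in> Q \<and> 0 \<in> sums_of_squares" by simp
  then show "s \<in> {s + t * a |s t. s \<in> Q \<and> t \<in> sums_of_squares}" by blast
qed

lemma qm_adjoin_mem: "a \<in> {s + t * a |s t. s \<in> Q \<and> t \<in> sums_of_squares}"
proof -
  have "a = 0 + 1 * a \<and> 0 \<in> Q \<and> 1 \<in> sums_of_squares"
    using qm_zero by simp
  then show ?thesis by blast
qed

lemma qm_adjoin:
  "quadratic_module {s + t * a |s t. s \<in> Q \<and> t \<in> sums_of_squares}" (is "quadratic_module ?M")
  unfolding quadratic_module_def
proof (intro conjI ballI allI)
  show "1 \<in> ?M"
    using qm_one qm_adjoin_subset by blast
next
  fix f g assume "f \<in> ?M" "g \<in> ?M"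
  then obtain s t s' t' where "f = s + t * a" "g = s' + t' * a"
    "s \<in> Q" "s' \<in> Q" "t \<in> sums_of_squares" "t' \<in> sums_of_squares"
    by blast
  then have "f + g = (s + s') + (t + t') * a" "s + s' \<in> Q" "t + t' \<in> sums_of_squares"
    by (auto simp: algebra_simps intro: qm_add sos_add)
  then show "f + g \<in> ?M" by blast
next
  fix f h assume "f \<in> ?M"
  then obtain s t where "f = s + t * a" "s \<in> Q" "t \<in> sums_of_squares"
    by blast
  then have "h\<^sup>2 * f = h\<^sup>2 * s + (h\<^sup>2 * t) * a" "h\<^sup>2 * s \<in> Q" "h\<^sup>2 * t \<in> sums_of_squares"
    by (simp_all add: distrib_left mult.assoc qm_square_mult sos_square_mult)
  then show "h\<^sup>2 * f \<in> ?M" by blast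
qed

text \<open>Zorn's lemma: two elements of the union of a chain already lie in one member, and
  excluding \<open>- 1\<close> passes to unions.\<close>

lemma qm_extend_maximal:
  assumes "- 1 \<notin> Q"
  obtains M where "quadratic_module M" "Q \<subseteq> M" "- 1 \<notin> M"
    "\<And>M'. quadratic_module M' \<Longrightarrow> M \<subseteq> M' \<Longrightarrow> - 1 \<notin> M' \<Longrightarrow> M' = M"
proof -
  let ?P = "{M. quadratic_module M \<and> Q \<subseteq> M \<and> - 1 \<notin> M}"
  have "\<exists>M\<in>?P. \<forall>X\<in>?P. M \<subseteq> X \<longrightarrow> X = M"
  proof (rule subset_Zorn_nonempty)
    show "?P \<noteq> {}" using Q assms by blast
  next
    fix \<C> assume ne: "\<C> \<noteq> {}" and ch: "subset.chain ?P \<C>"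
    then have sub: "\<C> \<subseteq> ?P" and lin: "X \<in> \<C> \<Longrightarrow> Y \<in> \<C> \<Longrightarrow> X \<subseteq> Y \<or> Y \<subseteq> X" for X Y
      by (auto simp: subset_chain_def)
    have "f + g \<in> \<Union>\<C>" if "f \<in> X" "g \<in> Y" "X \<in> \<C>" "Y \<in> \<C>" for f g X Y
    proof -
      obtain Z where Z: "Z \<in> \<C>" "f \<in> Z" "g \<in> Z"
        using lin[OF \<open>X \<in> \<C>\<close> \<open>Y \<in> \<C>\<close>] \<open>f \<in> X\<close> \<open>g \<in> Y\<close> \<open>X \<in> \<C>\<close> \<open>Y \<in> \<C>\<close> by blast
      then have "f + g \<in> Z" using sub by (auto simp: quadratic_module_def)
      then show ?thesis using Z by blast
    qed
    moreover have "1 \<in> \<Union>\<C>"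
      using sub ne by (auto simp: quadratic_module_def)
    moreover have "h\<^sup>2 * f \<in> \<Union>\<C>" if "f \<in> X" "X \<in> \<C>" for f h X
    proof -
      have "h\<^sup>2 * f \<in> X" using sub that by (auto simp: quadratic_module_def)
      then show ?thesis using that by blast
    qed
    ultimately have "quadratic_module (\<Union>\<C>)"
      unfolding quadratic_module_def by blast
    then show "\<Union>\<C> \<in> ?P" using sub ne by auto
  qed
  then obtain M where "M \<in> ?P" "\<forall>X\<in>?P. M \<subseteq> X \<longrightarrow> X = M" ..
  then show thesis using that[of M] by blast
qed

text \<open>If \<open>f\<close> and \<open>- f\<close> were both missing, adjoining either one would
  produce \<open>- 1\<close>. Eliminating \<open>f\<close> from the two identities puts \<tau> into
  the support, which is an ideal, and then the second identity gives \<open>- 1\<close> inside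
  \<open>Q\<close>.\<close>

lemma qm_maximal_total:
  assumes proper: "- 1 \<notin> Q"
    and max: "\<And>M. quadratic_module M \<Longrightarrow> Q \<subseteq> M \<Longrightarrow> - 1 \<notin> M \<Longrightarrow> M = Q"
  shows "f \<in> Q \<or> - f \<in> Q"
proof (rule ccontr)
  assume not: "\<not> (f \<in> Q \<or> - f \<in> Q)"
  have *: "\<exists>s t. - 1 = s + t * a \<and> s \<in> Q \<and> t \<in> sums_of_squares" if "a \<notin> Q" for a
  proof -
    have "- 1 \<in> {s + t * a |s t. s \<in> Q \<and> t \<in> sums_of_squares}"
      using max[OF qm_adjoin qm_adjoin_subset, of a] qm_adjoin_mem[of a] that by blast
    then show ?thesis by blast
  qed
  obtain s \<sigma> where s: "- 1 = s + \<sigma> * f" "s \<in> Q" "\<sigma> \<in> sums_of_squares"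
    using *[of f] not by blast
  obtain t \<tau> where t: "- 1 = t + \<tau> * (- f)" "t \<in> Q" "\<tau> \<in> sums_of_squares"
    using *[of "- f"] not by blast
  \<comment> \<open>The multipliers \<tau> and \<sigma> are chosen so that the terms with
    \<open>f\<close> cancel.\<close>
  have "\<tau> * (s + \<sigma> * f) + \<sigma> * (t + \<tau> * (- f)) = \<tau> * s + \<sigma> * t"
    by (simp add: algebra_simps)
  then have "\<tau> * (- 1) + \<sigma> * (- 1) = \<tau> * s + \<sigma> * t"
    unfolding s(1)[symmetric] t(1)[symmetric] .
  moreover have "- \<tau> = \<sigma> + (\<tau> * (- 1) + \<sigma> * (- 1))" by simp
  ultimately have "- \<tau> = \<sigma> + (\<tau> * s + \<sigma> * t)" by (simp only:)
  also have "\<dots> \<in> Q"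
    by (intro qm_add qm_sos_mult qm_sos[OF s(3)] s(2,3) t(2,3))
  finally have "- \<tau> \<in> Q" .
  then have "(- f) * \<tau> \<in> Q"
    by (intro qm_support_mult qm_sos[OF t(3)])
  then have "t + \<tau> * (- f) \<in> Q"
    using t(2) by (intro qm_add) (simp_all add: mult.commute)
  then show False using t(1) proper by simp
qed

end

subsection \<open>The archimedean Positivstellensatz\<close>

lemma archimedean_qmD:
  assumes "archimedean_qm Q"
  obtains c where "0 < c" "pconst c - f \<in> Q" "pconst c + f \<in> Q"
proof -
  have Q: "quadratic_module Q" using assms by (simp add: archimedean_qm_def)
  have *: "\<exists>c. pconst c - g \<in> Q" for g
    using assms by (metis archimedean_qm_def pconst_of_nat)
  obtain a b where "pconst a - f \<in> Q" "pconst b - (- f) \<in> Q"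
    using *[of f] *[of "- f"] by blast
  \<comment> \<open>One constant serves both signs; the maximum with 1 makes it positive.\<close>
  then have "pconst (max 1 (max a b)) - f \<in> Q" "pconst (max 1 (max a b)) - (- f) \<in> Q"
    by (auto intro: qm_mono_const[OF Q] simp del: diff_minus_eq_add)
  then show thesis using that[of "max 1 (max a b)"] by simp
qed

lemma archimedean_qm_superset:
  "archimedean_qm Q \<Longrightarrow> quadratic_module M \<Longrightarrow> Q \<subseteq> M \<Longrightarrow> archimedean_qm M"
  unfolding archimedean_qm_def by blast

text \<open>For a proper archimedean \<open>M\<close> that contains \<open>f\<close> or
  \<open>- f\<close> for every \<open>f\<close>, these elements are the kernel of a ring
  homomorphism to the reals.\<close>

definition qm_infinitesimal :: "'n rpoly set \<Rightarrow> 'n rpoly \<Rightarrow> bool"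
  where "qm_infinitesimal M g \<longleftrightarrow> (\<forall>e>0. pconst e + g \<in> M \<and> pconst e - g \<in> M)"

section \<open>Infinitesimal elements under ring operations\<close>

context
  fixes M :: "'n rpoly set"
  assumes M: "quadratic_module M"
begin

lemma qm_infinitesimal_0: "qm_infinitesimal M 0"
  by (simp add: qm_infinitesimal_def qm_pconst[OF M])

lemma qm_infinitesimal_uminus: "qm_infinitesimal M f \<Longrightarrow> qm_infinitesimal M (- f)"
  by (simp add: qm_infinitesimal_def)

lemma qm_infinitesimal_add:
  assumes "qm_infinitesimal M f" "qm_infinitesimal M g"
  shows "qm_infinitesimal M (f + g)"
  unfolding qm_infinitesimal_def
proof (intro allI impI)
  fix e :: real assume "0 < e"
  then have e: "0 < e / 2" by simp
  have "pconst e + (f + g) = (pconst (e / 2) + f) + (pconst (e / 2) + g)"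
    "pconst e - (f + g) = (pconst (e / 2) - f) + (pconst (e / 2) - g)"
    using pconst_add[of "e / 2" "e / 2"] by simp_all
  moreover have "pconst (e / 2) + f \<in> M" "pconst (e / 2) - f \<in> M"
    "pconst (e / 2) + g \<in> M" "pconst (e / 2) - g \<in> M"
    using assms e by (auto simp: qm_infinitesimal_def)
  ultimately show "pconst e + (f + g) \<in> M \<and> pconst e - (f + g) \<in> M"
    using qm_add[OF M] by metis
qed

lemma qm_infinitesimal_scale:
  assumes "qm_infinitesimal M f"
  shows "qm_infinitesimal M (pconst c * f)"
proof -
  have pos: "qm_infinitesimal M (pconst c * g)" if g: "qm_infinitesimal M g" and "0 < c" for c g
    unfolding qm_infinitesimal_def
  proof (intro allI impI)
    fix e :: real assume "0 < e"
    then have "0 < e / c" using \<open>0 < c\<close> by simp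
    then have "pconst c * (pconst (e / c) + g) \<in> M" "pconst c * (pconst (e / c) - g) \<in> M"
      using g \<open>0 < c\<close> by (auto simp: qm_infinitesimal_def intro!: qm_scale[OF M])
    moreover have "pconst c * pconst (e / c) = pconst e"
      using \<open>0 < c\<close> by (simp flip: pconst_mult)
    ultimately show "pconst e + pconst c * g \<in> M \<and> pconst e - pconst c * g \<in> M"
      by (metis distrib_left right_diff_distrib)
  qed
  consider "c = 0" | "0 < c" | "0 < - c" by linarith
  then show ?thesis
  proof cases
    case 1
    then show ?thesis using qm_infinitesimal_0 by simp
  next
    case 2
    then show ?thesis using pos assms by blast
  next
    case 3
    then show ?thesis using pos[OF qm_infinitesimal_uminus[OF assms] 3] by (simp add: pconst_minus)
  qed
qed

lemma qm_infinitesimal_square: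
  assumes "qm_infinitesimal M f"
  shows "qm_infinitesimal M (f\<^sup>2)"
  unfolding qm_infinitesimal_def
proof (intro allI impI conjI)
  fix e :: real assume e: "0 < e"
  show "pconst e + f\<^sup>2 \<in> M"
    using e by (intro qm_add[OF M] qm_pconst[OF M] qm_square[OF M]) simp
  \<comment> \<open>The bound for squares is applied with \<open>sqrt e\<close>, whose square is the
    required tolerance.\<close>
  have "pconst ((sqrt e)\<^sup>2) - f\<^sup>2 \<in> M"
    using assms e by (intro qm_square_bound[OF M]) (auto simp: qm_infinitesimal_def)
  then show "pconst e - f\<^sup>2 \<in> M" using e by simp
qed

text \<open>Polarisation writes the product through squares, avoiding any closure of
  \<open>M\<close> under products.\<close>

lemma qm_infinitesimal_mult:
  assumes "qm_infinitesimal M f" "qm_infinitesimal M g"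
  shows "qm_infinitesimal M (f * g)"
proof -
  have "qm_infinitesimal M (pconst (1 / 4) * ((f + g)\<^sup>2 + - ((f + - g)\<^sup>2)))"
    using assms
    by (intro qm_infinitesimal_scale qm_infinitesimal_add qm_infinitesimal_uminus
        qm_infinitesimal_square)
  also have "(f + g)\<^sup>2 + - ((f + - g)\<^sup>2) = pconst 4 * (f * g)"
    by (simp add: pconst_numeral power2_eq_square algebra_simps)
  also have "pconst (1 / 4) * (pconst 4 * (f * g)) = f * g"
    by (simp flip: mult.assoc pconst_mult)
  finally show ?thesis .
qed

end

text \<open>The value of \<open>f\<close> is a Dedekind cut: the supremum of the reals
  \<open>r\<close> with \<open>f - r\<close> in \<open>M\<close>. The archimedean property makes
  this set nonempty, and together with properness it bounds the set above.\<close>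

lemma archimedean_total_qm_value:
  assumes arch: "archimedean_qm M" and proper: "- 1 \<notin> M"
    and total: "\<And>f. f \<in> M \<or> - f \<in> M"
  obtains a where "qm_infinitesimal M (f - pconst a)"
proof -
  have M: "quadratic_module M" using arch by (simp add: archimedean_qm_def)
  obtain c where c: "pconst c - f \<in> M" "pconst c + f \<in> M"
    using archimedean_qmD[OF arch] by blast
  define L where "L = {r. f - pconst r \<in> M}"
  have "- c \<in> L" using c by (simp add: L_def pconst_minus add.commute)
  have "r \<le> c" if "r \<in> L" for r
    using qm_pconst_nonneg[OF M proper, of "c - r"] qm_add[OF M c(1), of "f - pconst r"] that
    by (simp add: L_def pconst_diff)
  then have bdd: "bdd_above L" by (auto simp: bdd_above_def)
  have "pconst e + (f - pconst (Sup L)) \<in> M \<and> pconst e - (f - pconst (Sup L)) \<in> M" if "0 < e" for e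
  proof
    obtain r where "r \<in> L" "Sup L - e < r"
      using less_cSupE[of "Sup L - e" L] \<open>- c \<in> L\<close> \<open>0 < e\<close> by auto
    then have "(f - pconst r) + pconst (r - (Sup L - e)) \<in> M"
      by (intro qm_add[OF M] qm_pconst[OF M]) (auto simp: L_def)
    then show "pconst e + (f - pconst (Sup L)) \<in> M"
      by (simp add: pconst_hom algebra_simps)
    \<comment> \<open>Beyond the supremum membership fails, so totality puts the negated difference
      into \<open>M\<close>.\<close>
    have "Sup L + e \<notin> L"
      using cSup_upper[OF _ bdd, of "Sup L + e"] that by auto
    then have "- (f - pconst (Sup L + e)) \<in> M"
      using total[of "f - pconst (Sup L + e)"] by (auto simp: L_def)
    then show "pconst e - (f - pconst (Sup L)) \<in> M"
      by (simp add: pconst_hom algebra_simps)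
  qed
  then show thesis using that[of "Sup L"] by (simp add: qm_infinitesimal_def)
qed

text \<open>The point collects the values of the variables. By induction every \<open>f\<close>
  differs from its value there by an infinitesimal, so a negative value of some \<open>f\<close> in
  \<open>M\<close> would force a negative constant into \<open>M\<close>.\<close>

lemma archimedean_total_qm_point:
  assumes arch: "archimedean_qm M" and proper: "- 1 \<notin> M"
    and total: "\<And>f. f \<in> M \<or> - f \<in> M"
  obtains x where "\<And>f. f \<in> M \<Longrightarrow> 0 \<le> peval f x"
proof -
  have M: "quadratic_module M" using arch by (simp add: archimedean_qm_def)
  have "\<exists>a. \<forall>i. qm_infinitesimal M (pvar i - pconst (a i))"
    by (intro choice allI) (blast intro: archimedean_total_qm_value[OF assms])
  then obtain a where a: "qm_infinitesimal M (pvar i - pconst (a i))" for i by blast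
  define x where "x = (\<chi> i. a i)"
  have inf: "qm_infinitesimal M (f - pconst (peval f x))" for f
  proof (induction f rule: rpoly_induct)
    case (pconst c)
    then show ?case by (simp add: qm_infinitesimal_0[OF M])
  next
    case (pvar i)
    then show ?case using a by (simp add: x_def)
  next
    case (add p q)
    then show ?case using qm_infinitesimal_add[OF M add] by (simp add: pconst_add algebra_simps)
  next
    case (mult p q)
    let ?p = "p - pconst (peval p x)" and ?q = "q - pconst (peval q x)"
    \<comment> \<open>The error of a product, expanded through the errors of its factors.\<close>
    have "qm_infinitesimal M (?p * ?q + (pconst (peval p x) * ?q + pconst (peval q x) * ?p))"
      using mult
      by (intro qm_infinitesimal_add[OF M] qm_infinitesimal_mult[OF M] qm_infinitesimal_scale[OF M])
    also have "?p * ?q + (pconst (peval p x) * ?q + pconst (peval q x) * ?p)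
        = p * q - pconst (peval (p * q) x)"
      by (simp add: pconst_mult algebra_simps)
    finally show ?case .
  qed
  have "0 \<le> peval f x" if "f \<in> M" for f
  proof (rule ccontr)
    assume neg: "\<not> 0 \<le> peval f x"
    \<comment> \<open>The tolerance is half of the absolute value at \<open>x\<close>; adding
      \<open>f\<close> then leaves the constant \<open>peval f x / 2\<close>, which is
      negative.\<close>
    then have "pconst (- peval f x / 2) - (f - pconst (peval f x)) \<in> M"
      using inf[of f] by (simp add: qm_infinitesimal_def)
    then have "(pconst (- peval f x / 2) - (f - pconst (peval f x))) + f \<in> M"
      using that by (rule qm_add[OF M])
    then have "pconst (- peval f x / 2 + peval f x) \<in> M"
      unfolding pconst_add by simp
    then have "0 \<le> - peval f x / 2 + peval f x"
      by (rule qm_pconst_nonneg[OF M proper])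
    with neg show False by simp
  qed
  then show thesis by (rule that)
qed

lemma archimedean_qm_proper_point:
  assumes "archimedean_qm Q" "- 1 \<notin> Q"
  obtains x where "\<And>f. f \<in> Q \<Longrightarrow> 0 \<le> peval f x"
proof -
  have Q: "quadratic_module Q" using assms by (simp add: archimedean_qm_def)
  obtain M where M: "quadratic_module M" "Q \<subseteq> M" "- 1 \<notin> M"
    and max: "\<And>M'. quadratic_module M' \<Longrightarrow> M \<subseteq> M' \<Longrightarrow> - 1 \<notin> M' \<Longrightarrow> M' = M"
    using qm_extend_maximal[OF Q assms(2)] by blast
  have "archimedean_qm M"
    using assms(1) M archimedean_qm_superset by blast
  then obtain x where "\<And>f. f \<in> M \<Longrightarrow> 0 \<le> peval f x"
    using archimedean_total_qm_point M(3) qm_maximal_total[OF M(1,3) max] by metis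
  then show thesis using that M(2) by blast
qed

text \<open>Each step lowers the constant \<open>r\<close> by the fixed amount \<open>1 / k\<^sup>2\<close>, for \<open>k\<close> depending only on
  \<open>\<sigma>\<close> and \<open>p\<close>; no multiplicative closure of \<open>Q\<close> is needed.\<close>

lemma archimedean_positivstellensatz_step:
  assumes Q: "quadratic_module Q" and k: "0 < k" and r: "0 \<le> r"
    and \<sigma>: "\<sigma> \<in> sums_of_squares" "\<sigma> * p - 1 \<in> Q"
    and b: "pconst (2 * k) - \<sigma> \<in> Q" "pconst (2 * k - 1) - \<sigma>\<^sup>2 * p \<in> Q"
    and p: "p + pconst r \<in> Q"
  shows "p + pconst (r - 1 / k\<^sup>2) \<in> Q"
proof (rule qm_unscale[OF Q])
  show "0 < k\<^sup>2" using k by simp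
  have "pconst (k\<^sup>2) * pconst (1 / k\<^sup>2) = 1"
    using k by (simp flip: pconst_mult)
  then have "pconst (k\<^sup>2) * (p + pconst (r - 1 / k\<^sup>2)) = pconst (k\<^sup>2) * (p + pconst r) - 1"
    by (simp add: pconst_diff algebra_simps)
  \<comment> \<open>The element \<open>p + pconst r\<close> enters with the square weight of
    \<open>k - \<sigma>\<close>, and the other summands correct the expansion. The last one combines
    \<open>r \<ge> 0\<close>, a sum of squares and the upper bound on \<sigma>.\<close>
  also have "\<dots> = (pconst k - \<sigma>)\<^sup>2 * (p + pconst r) + pconst (2 * k) * (\<sigma> * p - 1)
      + (pconst (2 * k - 1) - \<sigma>\<^sup>2 * p) + pconst r * (\<sigma> * (pconst (2 * k) - \<sigma>))"
    by (simp add: pconst_hom power2_eq_square algebra_simps)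
  also have "\<dots> \<in> Q"
    using k r by (intro qm_add[OF Q] qm_square_mult[OF Q] qm_scale[OF Q] qm_sos_mult[OF Q] \<sigma> b p) auto
  finally show "pconst (k\<^sup>2) * (p + pconst (r - 1 / k\<^sup>2)) \<in> Q" .
qed

theorem archimedean_positivstellensatz:
  assumes arch: "archimedean_qm Q"
    and pos: "\<And>x. (\<And>q. q \<in> Q \<Longrightarrow> 0 \<le> peval q x) \<Longrightarrow> 0 < peval p x"
  shows "p \<in> Q"
proof -
  have Q: "quadratic_module Q" using arch by (simp add: archimedean_qm_def)
  let ?M = "{s + t * (- p) |s t. s \<in> Q \<and> t \<in> sums_of_squares}"
  have M: "quadratic_module ?M" by (rule qm_adjoin[OF Q])
  have "Q \<subseteq> ?M" by (rule qm_adjoin_subset[OF Q])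
  have "- 1 \<in> ?M"
  proof (rule ccontr)
    assume "- 1 \<notin> ?M"
    then obtain x where x: "\<And>f. f \<in> ?M \<Longrightarrow> 0 \<le> peval f x"
      using archimedean_qm_proper_point[OF archimedean_qm_superset[OF arch M \<open>Q \<subseteq> ?M\<close>]] by blast
    then have "0 < peval p x" using pos \<open>Q \<subseteq> ?M\<close> by blast
    moreover have "- p \<in> ?M" by (rule qm_adjoin_mem[OF Q])
    ultimately show False using x[of "- p"] by simp
  qed
  then obtain s \<sigma> where \<sigma>: "- 1 = s + \<sigma> * (- p)" "s \<in> Q" "\<sigma> \<in> sums_of_squares"
    by blast
  have "\<sigma> * p - 1 = \<sigma> * p + (s + \<sigma> * (- p))"
    unfolding \<sigma>(1)[symmetric] by simp
  then have sp: "\<sigma> * p - 1 \<in> Q" using \<sigma>(2) by simp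
  obtain a where a: "0 < a" "pconst a - \<sigma> \<in> Q" using archimedean_qmD[OF arch] by metis
  obtain b where b: "0 < b" "pconst b - \<sigma>\<^sup>2 * p \<in> Q" using archimedean_qmD[OF arch] by metis
  \<comment> \<open>This choice gives both \<open>a \<le> 2 * k\<close> and
    \<open>b \<le> 2 * k - 1\<close>, the two bounds needed in the descent step.\<close>
  define k where "k = a + b + 1"
  have k: "0 < k" using a b by (simp add: k_def)
  have ka: "pconst (2 * k) - \<sigma> \<in> Q" and kb: "pconst (2 * k - 1) - \<sigma>\<^sup>2 * p \<in> Q"
    using a b by (auto simp: k_def intro: qm_mono_const[OF Q])
  obtain c where c: "0 < c" "pconst c + p \<in> Q" using archimedean_qmD[OF arch] by metis
  \<comment> \<open>The step applies for \<open>r \<ge> 0\<close> only; the maximum with 0 allows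
    the descent to stop once \<open>r\<close> is no longer positive.\<close>
  have "\<exists>r \<le> max 0 (c - real n / k\<^sup>2). p + pconst r \<in> Q" for n
  proof (induction n)
    case 0
    show ?case using c by (auto simp: add.commute intro!: exI[of _ c])
  next
    case (Suc n)
    then obtain r where r: "r \<le> max 0 (c - real n / k\<^sup>2)" "p + pconst r \<in> Q" by blast
    show ?case
    proof (cases "r \<le> 0")
      case True
      then show ?thesis using r by (auto intro!: exI[of _ r])
    next
      case False
      then have "p + pconst (r - 1 / k\<^sup>2) \<in> Q"
        using archimedean_positivstellensatz_step[OF Q k _ \<sigma>(3) sp ka kb r(2)] by simp
      moreover have "r - 1 / k\<^sup>2 \<le> max 0 (c - real (Suc n) / k\<^sup>2)"
        using False r(1) by (simp add: add_divide_distrib)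
      ultimately show ?thesis by blast
    qed
  qed
  moreover obtain n where "c * k\<^sup>2 \<le> real n" using real_arch_simple by blast
  then have "max 0 (c - real n / k\<^sup>2) = 0" using k by (simp add: field_simps)
  ultimately obtain r where "r \<le> 0" "p + pconst r \<in> Q" by metis
  then have "(p + pconst r) + pconst (- r) \<in> Q"
    using qm_add[OF Q _ qm_pconst[OF Q, of "- r"], of "p + pconst r"] by simp
  then show ?thesis by (simp add: pconst_minus)
qed

text \<open>Bounded elements are closed under squares by \<open>c\<^sup>2 - f\<^sup>2 \<in> Q\<close>, hence under products by polarisation.\<close>

lemma archimedean_qm_generators:
  assumes Q: "quadratic_module Q"
    and gen: "\<And>i. \<exists>c>0. pconst c - pvar i \<in> Q \<and> pconst c + pvar i \<in> Q"
  shows "archimedean_qm Q"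
proof -
  define H where "H f \<longleftrightarrow> (\<exists>c>0. pconst c - f \<in> Q \<and> pconst c + f \<in> Q)" for f
  have add: "H (f + g)" if "H f" "H g" for f g
  proof -
    obtain c d where "0 < c" "pconst c - f \<in> Q" "pconst c + f \<in> Q"
      "0 < d" "pconst d - g \<in> Q" "pconst d + g \<in> Q"
      using \<open>H f\<close> \<open>H g\<close> by (auto simp: H_def)
    then have "0 < c + d" "(pconst c - f) + (pconst d - g) \<in> Q" "(pconst c + f) + (pconst d + g) \<in> Q"
      by (auto intro: qm_add[OF Q])
    then show ?thesis
      unfolding H_def by (intro exI[of _ "c + d"]) (simp add: pconst_add algebra_simps)
  qed
  have minus: "H (- f)" if "H f" for f
    using that by (auto simp: H_def)
  have square: "H (f\<^sup>2)" if Hf: "H f" for f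
  proof -
    obtain c where c: "0 < c" "pconst c - f \<in> Q" "pconst c + f \<in> Q"
      using Hf by (auto simp: H_def)
    moreover have "pconst (c\<^sup>2) + f\<^sup>2 \<in> Q"
      by (intro qm_add[OF Q] qm_pconst[OF Q] qm_square[OF Q]) simp
    ultimately show ?thesis
      unfolding H_def by (intro exI[of _ "c\<^sup>2"] conjI qm_square_bound[OF Q]) auto
  qed
  have const: "H (pconst a)" for a
    unfolding H_def
  proof (intro exI[of _ "\<bar>a\<bar> + 1"] conjI)
    show "pconst (\<bar>a\<bar> + 1) - pconst a \<in> Q" "pconst (\<bar>a\<bar> + 1) + pconst a \<in> Q"
      unfolding pconst_diff[symmetric] pconst_add[symmetric] by (auto intro!: qm_pconst[OF Q])
  qed simp
  \<comment> \<open>Polarisation bounds four times a product, so the factor has to be removed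
    afterwards.\<close>
  have quarter: "H f" if H4: "H (pconst 4 * f)" for f
  proof -
    obtain c where c: "0 < c" "pconst c - pconst 4 * f \<in> Q" "pconst c + pconst 4 * f \<in> Q"
      using H4 by (auto simp: H_def)
    have "pconst 4 * pconst (c / 4) = pconst c" by (simp flip: pconst_mult)
    then have "pconst 4 * (pconst (c / 4) - f) \<in> Q" "pconst 4 * (pconst (c / 4) + f) \<in> Q"
      unfolding distrib_left right_diff_distrib using c by metis+
    then show ?thesis
      unfolding H_def using c(1) qm_unscale[OF Q, of 4] by (intro exI[of _ "c / 4"]) auto
  qed
  have mult: "H (f * g)" if "H f" "H g" for f g
  proof (rule quarter)
    have "pconst 4 * (f * g) = (f + g)\<^sup>2 + - ((f + - g)\<^sup>2)"
      by (simp add: pconst_numeral power2_eq_square algebra_simps)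
    moreover have "H ((f + g)\<^sup>2 + - ((f + - g)\<^sup>2))" using that by (intro add minus square)
    ultimately show "H (pconst 4 * (f * g))" by simp
  qed
  have "H f" for f
    by (induction f rule: rpoly_induct) (use gen in \<open>auto simp: H_def[of "pvar _"] intro: const add mult\<close>)
  then have "\<exists>N::nat. of_nat N - f \<in> Q" for f
    unfolding H_def by (metis pconst_of_nat qm_mono_const[OF Q] real_arch_simple)
  then show ?thesis using Q by (simp add: archimedean_qm_def)
qed

subsection \<open>Positive semidefinite matrices as sums of rank-one matrices\<close>

definition outer :: "real ^ 'k \<Rightarrow> real ^ 'k ^ 'k"
  where "outer w = (\<chi> r s. w $ r * w $ s)"

text \<open>The inner product on matrices is the trace form, so pairing with the rank-one matrix of
  \<open>w\<close> evaluates the quadratic form at \<open>w\<close>.\<close>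

lemma inner_outer: "outer w \<bullet> M = w \<bullet> (M *v w)"
  by (simp add: outer_def inner_vec_def matrix_vector_mult_def sum_distrib_left ac_simps)

lemma outer_form: "v \<bullet> (outer w *v v) = (v \<bullet> w)\<^sup>2"
proof -
  have "outer w *v v = (w \<bullet> v) *\<^sub>R w"
    by (simp add: vec_eq_iff outer_def inner_vec_def matrix_vector_mult_def sum_distrib_left ac_simps)
  then show ?thesis by (simp add: power2_eq_square inner_commute)
qed

lemma symmetric_matrix_outer: "symmetric_matrix (outer w)"
  by (simp add: symmetric_matrix_def outer_def transpose_def vec_eq_iff mult.commute)

lemma symmetric_matrix_inner_commute:
  fixes M :: "real ^ 'k ^ 'k"
  assumes "symmetric_matrix M"
  shows "u \<bullet> (M *v v) = v \<bullet> (M *v u)"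
  using assms
  by (metis dot_lmul_matrix inner_commute symmetric_matrix_def vector_transpose_matrix)

lemma symmetric_matrix_add:
  "symmetric_matrix M \<Longrightarrow> symmetric_matrix N \<Longrightarrow> symmetric_matrix (M + N)"
  by (simp add: symmetric_matrix_def transpose_def vec_eq_iff)

lemma symmetric_matrix_diff:
  "symmetric_matrix M \<Longrightarrow> symmetric_matrix N \<Longrightarrow> symmetric_matrix (M - N)"
  by (simp add: symmetric_matrix_def transpose_def vec_eq_iff)

lemma symmetric_matrix_scaleR:
  fixes M :: "real ^ 'k ^ 'k"
  shows "symmetric_matrix M \<Longrightarrow> symmetric_matrix (c *\<^sub>R M)"
  by (simp add: symmetric_matrix_def transpose_def vec_eq_iff)

lemma symmetric_matrix_0: "symmetric_matrix (0 :: real ^ 'k ^ 'k)"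
  by (simp add: symmetric_matrix_def transpose_def vec_eq_iff)

lemma symmetric_matrix_sum:
  fixes M :: "'i \<Rightarrow> real ^ 'k ^ 'k"
  shows "(\<And>i. i \<in> I \<Longrightarrow> symmetric_matrix (M i)) \<Longrightarrow> symmetric_matrix (sum M I)"
  by (induction I rule: infinite_finite_induct) (auto simp: symmetric_matrix_0 intro: symmetric_matrix_add)

lemma form_add_scaled_axis:
  fixes M :: "real ^ 'k ^ 'k"
  assumes "symmetric_matrix M"
  shows "(v + t *\<^sub>R axis i 1) \<bullet> (M *v (v + t *\<^sub>R axis i 1))
    = v \<bullet> (M *v v) + 2 * t * (v \<bullet> (M *v axis i 1)) + t\<^sup>2 * M $ i $ i"
proof -
  have "axis i 1 \<bullet> (M *v axis i 1) = M $ i $ i"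
    by (simp add: inner_axis' matrix_vector_mult_basis column_def)
  then show ?thesis
    using symmetric_matrix_inner_commute[OF assms, of "axis i 1" v]
    by (simp add: matrix_vector_right_distrib matrix_vector_mult_scaleR inner_add_left
        inner_add_right power2_eq_square algebra_simps)
qed

lemma diagonal_eq_form: "M $ i $ i = axis i 1 \<bullet> (M *v axis i (1::real))"
  by (simp add: inner_axis' matrix_vector_mult_basis column_def)

lemma pos_semidef_diagonal_nonneg: "pos_semidef M \<Longrightarrow> 0 \<le> M $ i $ i"
  by (simp add: pos_semidef_def diagonal_eq_form)

text \<open>With zero diagonal the form at \<open>axis r 1 + t *\<^sub>R axis s 1\<close> is linear
  in \<open>t\<close> with slope \<open>2 * M $ r $ s\<close>; nonnegativity for both signs of
  \<open>t\<close> forces the slope to vanish.\<close>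

lemma pos_semidef_zero_diagonal:
  assumes M: "pos_semidef M" and diag: "\<And>i. M $ i $ i = 0"
  shows "M = 0"
proof -
  have sym: "symmetric_matrix M" and psd: "\<And>v. 0 \<le> v \<bullet> (M *v v)"
    using M by (auto simp: pos_semidef_def)
  have entry: "axis r 1 \<bullet> (M *v axis s 1) = M $ r $ s" for r s
    by (simp add: inner_axis' matrix_vector_mult_basis column_def)
  have "0 \<le> 2 * t * M $ r $ s" for r s t
    using form_add_scaled_axis[OF sym, of "axis r 1" t s] psd[of "axis r 1 + t *\<^sub>R axis s 1"] diag
    by (simp add: entry)
  from this[of 1] this[of "- 1"] show ?thesis
    by (simp add: vec_eq_iff) (metis dual_order.antisym)
qed

text \<open>One step of a Cholesky elimination.\<close>

lemma pos_semidef_eliminate: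
  assumes M: "pos_semidef M" and pos: "0 < M $ i $ i"
  defines "M' \<equiv> M - outer ((1 / sqrt (M $ i $ i)) *\<^sub>R (M *v axis i 1))"
  shows "pos_semidef M'" "M' $ i $ i = 0" "\<And>j. M $ j $ j = 0 \<Longrightarrow> M' $ j $ j = 0"
proof -
  let ?a = "M $ i $ i" and ?w = "M *v axis i 1"
  have sym: "symmetric_matrix M" and psd: "\<And>v. 0 \<le> v \<bullet> (M *v v)"
    using M by (auto simp: pos_semidef_def)
  have form: "v \<bullet> (M' *v v) = v \<bullet> (M *v v) - (v \<bullet> ?w)\<^sup>2 / ?a" for v
    using pos by (simp add: M'_def matrix_vector_mult_diff_rdistrib inner_diff_right outer_form
        power_divide)
  have "0 \<le> v \<bullet> (M' *v v)" for v
  proof -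
    \<comment> \<open>This is the minimiser in \<open>t\<close> of the form at
      \<open>v + t *\<^sub>R axis i 1\<close>; the minimum is the eliminated form at
      \<open>v\<close>.\<close>
    let ?t = "- (v \<bullet> ?w) / ?a"
    have "0 \<le> v \<bullet> (M *v v) + 2 * ?t * (v \<bullet> ?w) + ?t\<^sup>2 * ?a"
      using psd form_add_scaled_axis[OF sym, of v ?t i] by metis
    also have "\<dots> = v \<bullet> (M' *v v)"
      unfolding form using pos by (simp add: field_simps power2_eq_square)
    finally show ?thesis .
  qed
  moreover have "symmetric_matrix M'"
    unfolding M'_def by (intro symmetric_matrix_diff sym symmetric_matrix_outer)
  ultimately show M': "pos_semidef M'" by (simp add: pos_semidef_def)
  show "M' $ i $ i = 0"
    using pos form[of "axis i 1"] by (simp flip: diagonal_eq_form) (simp add: power2_eq_square)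
  show "M' $ j $ j = 0" if "M $ j $ j = 0" for j
  proof (rule antisym)
    show "M' $ j $ j \<le> 0"
      using form[of "axis j 1"] that pos by (simp flip: diagonal_eq_form)
  qed (rule pos_semidef_diagonal_nonneg[OF M'])
qed

text \<open>Each elimination clears one nonzero diagonal entry and creates no new one, so their
  number decreases until the matrix is zero.\<close>

lemma pos_semidef_sum_outer:
  "pos_semidef M \<Longrightarrow> \<exists>(N::nat) w. M = (\<Sum>j<N. outer (w j))"
proof (induction "card {i. M $ i $ i \<noteq> 0}" arbitrary: M rule: less_induct)
  case less
  show ?case
  proof (cases "\<exists>i. M $ i $ i \<noteq> 0")
    case False
    then have "M = 0" using pos_semidef_zero_diagonal[OF less.prems] by simp
    then show ?thesis by (intro exI[of _ 0]) simp
  next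
    case True
    then obtain i where i: "M $ i $ i \<noteq> 0" by blast
    then have pos: "0 < M $ i $ i"
      using pos_semidef_diagonal_nonneg[OF less.prems, of i] by simp
    define u where "u = (1 / sqrt (M $ i $ i)) *\<^sub>R (M *v axis i 1)"
    note elim = pos_semidef_eliminate[OF less.prems pos, folded u_def]
    have "{j. (M - outer u) $ j $ j \<noteq> 0} \<subset> {j. M $ j $ j \<noteq> 0}"
      using elim(2,3) i by blast
    then have "card {j. (M - outer u) $ j $ j \<noteq> 0} < card {j. M $ j $ j \<noteq> 0}"
      by (intro psubset_card_mono) auto
    from less.hyps[OF this elim(1)] obtain N :: nat and w where "M - outer u = (\<Sum>j<N. outer (w j))"
      by blast
    then have "M = (\<Sum>j<Suc N. outer ((w(N := u)) j))"
      by (simp add: algebra_simps)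
    then show ?thesis by blast
  qed
qed

subsection \<open>Duality for strictly feasible linear matrix inequalities\<close>

text \<open>The form attains a positive minimum on the compact unit sphere, and homogeneity extends
  the bound to all vectors.\<close>

lemma pos_def_coercive:
  assumes "pos_def L"
  obtains \<delta> where "0 < \<delta>" "\<And>v. \<delta> * (norm v)\<^sup>2 \<le> v \<bullet> (L *v v)"
proof -
  let ?S = "sphere 0 1 :: (real ^ 'a) set"
  have cont: "continuous_on ?S (\<lambda>v. v \<bullet> (L *v v))"
    by (intro continuous_intros linear_continuous_on matrix_vector_mul_bounded_linear)
  have "compact ?S" "?S \<noteq> {}" by simp_all
  from continuous_attains_inf[OF this cont]
  obtain u where u: "u \<in> ?S" "\<And>v. v \<in> ?S \<Longrightarrow> u \<bullet> (L *v u) \<le> v \<bullet> (L *v v)"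
    by blast
  have "u \<bullet> (L *v u) * (norm v)\<^sup>2 \<le> v \<bullet> (L *v v)" for v
  proof (cases "v = 0")
    case False
    have "u \<bullet> (L *v u) \<le> (v /\<^sub>R norm v) \<bullet> (L *v (v /\<^sub>R norm v))"
      using False by (intro u(2)) simp
    also have "\<dots> = v \<bullet> (L *v v) / (norm v)\<^sup>2"
      by (simp add: matrix_vector_mult_scaleR power2_eq_square field_simps)
    finally show ?thesis using False by (simp add: field_simps)
  qed simp
  moreover have "u \<noteq> 0" using u(1) by auto
  then have "0 < u \<bullet> (L *v u)" using assms u(1) by (simp add: pos_def_def)
  ultimately show thesis using that by blast
qed

text \<open>Positive definite matrices are interior to the cone of nonnegative forms: coercivity
  absorbs a small multiple of any \<open>V\<close>. The multiple is the coercivity constant divided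
  by an operator bound for \<open>V\<close>.\<close>

lemma pos_def_perturb:
  fixes L V :: "real ^ 'k ^ 'k"
  assumes "pos_def L"
  obtains \<epsilon> where "0 < \<epsilon>" "\<And>v. 0 \<le> v \<bullet> ((L + \<epsilon> *\<^sub>R V) *v v)"
proof -
  obtain \<delta> where \<delta>: "0 < \<delta>" "\<And>v. \<delta> * (norm v)\<^sup>2 \<le> v \<bullet> (L *v v)"
    using pos_def_coercive[OF assms] by blast
  obtain K where K: "0 < K" "\<And>v. norm (V *v v) \<le> norm v * K"
    using bounded_linear.pos_bounded[OF matrix_vector_mul_bounded_linear[of V]] by blast
  have "0 \<le> v \<bullet> ((L + (\<delta> / K) *\<^sub>R V) *v v)" for v
  proof -
    have "\<bar>v \<bullet> (V *v v)\<bar> \<le> norm v * norm (V *v v)" by (rule Cauchy_Schwarz_ineq2)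
    also have "\<dots> \<le> norm v * (norm v * K)" by (intro mult_left_mono K) simp
    finally have "- (K * (norm v)\<^sup>2) \<le> v \<bullet> (V *v v)" by (simp add: power2_eq_square algebra_simps)
    then have "(\<delta> / K) * (- (K * (norm v)\<^sup>2)) \<le> (\<delta> / K) * (v \<bullet> (V *v v))"
      using \<delta> K by (intro mult_left_mono) auto
    then show ?thesis
      using \<delta>(2)[of v] K(1)
      by (simp add: matrix_vector_mult_add_rdistrib inner_add_right scaleR_matrix_vector_assoc[symmetric])
  qed
  then show thesis using that[of "\<delta> / K"] \<delta> K by simp
qed

text \<open>Scaling \<open>A\<close> by an extra variable \<open>t\<close> homogenizes the pencil,
  making it linear in \<open>(t, x, y)\<close>.\<close>

lemma lin_matrix_combine:
  "lin_matrix ((u * t + v * t') *\<^sub>R A) B m C (u *\<^sub>R x + v *\<^sub>R x') (\<lambda>j. u * y j + v * y' j)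
    = u *\<^sub>R lin_matrix (t *\<^sub>R A) B m C x y + v *\<^sub>R lin_matrix (t' *\<^sub>R A) B m C x' y'"
  by (simp add: lin_matrix_def scaleR_add_left scaleR_add_right scaleR_sum_right sum.distrib)

lemma lin_matrix_scale:
  "lin_matrix ((u * t) *\<^sub>R A) B m C (u *\<^sub>R x) (\<lambda>j. u * y j) = u *\<^sub>R lin_matrix (t *\<^sub>R A) B m C x y"
  using lin_matrix_combine[of u t 0 0 A B m C x 0 y "\<lambda>_. 0"] by simp

lemma symmetric_lin_matrix:
  assumes "symmetric_matrix A" "\<And>i. symmetric_matrix (B i)" "\<And>j. j < m \<Longrightarrow> symmetric_matrix (C j)"
  shows "symmetric_matrix (lin_matrix A B m C x y)"
  unfolding lin_matrix_def using assms
  by (intro symmetric_matrix_add symmetric_matrix_sum symmetric_matrix_scaleR) auto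

text \<open>An affine function bounded below by 0 on a half-line cannot decrease. This removes
  additive slack from inequalities on cones.\<close>

lemma nonneg_slope:
  fixes a d :: real
  assumes "\<And>l. 0 \<le> l \<Longrightarrow> 0 \<le> l * a + d"
  shows "0 \<le> a"
proof (rule ccontr)
  assume a: "\<not> 0 \<le> a"
  then have "0 \<le> (\<bar>d\<bar> + 1) / (- a) * a + d" by (intro assms divide_nonneg_nonneg) auto
  also have "(\<bar>d\<bar> + 1) / (- a) * a = - (\<bar>d\<bar> + 1)" using a by (simp add: field_simps)
  finally show False by simp
qed

text \<open>Adding \<open>l\<close> times \<open>(t, x, y)\<close> to a feasible point and rescaling
  stays feasible. This treats \<open>t > 0\<close> and the recession directions \<open>t = 0\<close>
  alike, and \<open>l\<close> tending to infinity isolates the homogeneous part.\<close>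

lemma homogenized_nonneg:
  assumes sym: "symmetric_matrix A" "\<And>i. symmetric_matrix (B i)" "\<And>j. j < m \<Longrightarrow> symmetric_matrix (C j)"
    and feas: "strictly_feasible A B m C"
    and nonneg: "\<And>x. x \<in> proj_spectrahedron A B m C \<Longrightarrow> 0 \<le> c + b \<bullet> x"
    and t: "0 \<le> t" and psd: "\<And>v. 0 \<le> v \<bullet> (lin_matrix (t *\<^sub>R A) B m C x y *v v)"
  shows "0 \<le> t * c + b \<bullet> x"
proof -
  obtain x0 y0 where L0: "pos_def (lin_matrix A B m C x0 y0)"
    using feas by (auto simp: strictly_feasible_def)
  have "0 \<le> l * (t * c + b \<bullet> x) + (c + b \<bullet> x0)" if l: "0 \<le> l" for l
  proof -
    \<comment> \<open>This factor rescales the homogenizing coordinate \<open>1 + l * t\<close> back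
      to 1.\<close>
    define d where "d = 1 / (1 + l * t)"
    have "0 < 1 + l * t" using l t by (simp add: add_pos_nonneg)
    then have d: "0 < d" "d * (1 + l * t) = 1" by (simp_all add: d_def)
    let ?x = "d *\<^sub>R (1 *\<^sub>R x0 + l *\<^sub>R x)" and ?y = "\<lambda>j. d * (1 * y0 j + l * y j)"
    have eq: "lin_matrix A B m C ?x ?y
        = d *\<^sub>R (lin_matrix A B m C x0 y0 + l *\<^sub>R lin_matrix (t *\<^sub>R A) B m C x y)"
      using lin_matrix_scale[of d "1 * 1 + l * t" A B m C "1 *\<^sub>R x0 + l *\<^sub>R x" "\<lambda>j. 1 * y0 j + l * y j"]
        lin_matrix_combine[of 1 1 l t A B m C x0 x y0 y] d(2)
      by simp
    have "0 \<le> v \<bullet> (lin_matrix A B m C x0 y0 *v v)" for v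
      using L0 by (cases "v = 0") (auto simp: pos_def_def less_imp_le)
    then have "0 \<le> v \<bullet> (lin_matrix A B m C ?x ?y *v v)" for v
      unfolding eq using d l psd
      by (simp add: scaleR_matrix_vector_assoc[symmetric] matrix_vector_mult_add_rdistrib inner_add_right)
    moreover have "symmetric_matrix (lin_matrix A B m C ?x ?y)"
      by (intro symmetric_lin_matrix sym)
    ultimately have "?x \<in> proj_spectrahedron A B m C"
      unfolding proj_spectrahedron_def pos_semidef_def by blast
    then have "0 \<le> c + b \<bullet> ?x" by (rule nonneg)
    then have "0 \<le> (1 + l * t) * (c + b \<bullet> ?x)"
      using l t by (intro mult_nonneg_nonneg) auto
    also have "\<dots> = (1 + l * t) * c + (d * (1 + l * t)) * (b \<bullet> (x0 + l *\<^sub>R x))"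
      by (simp add: algebra_simps)
    finally show ?thesis
      unfolding d(2) by (simp add: inner_add_right algebra_simps)
  qed
  then show ?thesis by (rule nonneg_slope)
qed

text \<open>The cone of matrices with nonnegative quadratic form is taken without symmetry: it then has
  the positive definite matrices in its interior, and a functional that is nonnegative on it is
  automatically given by a symmetric matrix.\<close>

lemma dual_cone_pos_semidef:
  fixes W :: "real ^ 'k ^ 'k"
  assumes "\<And>P. (\<And>v. 0 \<le> v \<bullet> (P *v v)) \<Longrightarrow> 0 \<le> W \<bullet> P"
  shows "pos_semidef W"
proof -
  have "0 \<le> v \<bullet> (W *v v)" for v
    using assms[of "outer v"] by (simp add: outer_form inner_outer inner_commute[of W])
  moreover have "symmetric_matrix W"
  proof -
    let ?D = "W - transpose W"
    have "v \<bullet> (?D *v v) = 0" for v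
    proof -
      have "v \<bullet> (transpose W *v v) = v \<bullet> (W *v v)"
        by (metis dot_lmul_matrix inner_commute transpose_matrix_vector)
      then show ?thesis by (simp add: matrix_vector_mult_diff_rdistrib inner_diff_right)
    qed
    moreover from this have "v \<bullet> ((- ?D) *v v) = 0" for v
      by (simp add: matrix_vector_mult_diff_rdistrib inner_diff_right)
    ultimately have "W \<bullet> ?D = 0"
      using assms[of ?D] assms[of "- ?D"] by (simp add: inner_diff_right)
    moreover have "transpose W \<bullet> transpose W = W \<bullet> W"
      unfolding inner_vec_def transpose_def by simp (rule sum.swap)
    ultimately have "?D \<bullet> ?D = 0"
      by (simp add: inner_diff_right inner_diff_left inner_commute)
    then show ?thesis by (simp add: symmetric_matrix_def)
  qed
  ultimately show ?thesis by (simp add: pos_semidef_def)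
qed

text \<open>A hyperplane separating 0 from the convex set \<open>T\<close> has normal
  \<open>(V, z, \<rho>)\<close>. Strict feasibility makes \<rho> positive, and dividing by it turns
  \<open>V\<close> and \<open>z\<close> into the multiplier \<open>W\<close> and the slack
  \<open>s\<close>.\<close>

lemma lin_matrix_duality:
  fixes A :: "real ^ 'k ^ 'k" and B :: "'n::finite \<Rightarrow> real ^ 'k ^ 'k" and C :: "nat \<Rightarrow> real ^ 'k ^ 'k"
  assumes sym: "symmetric_matrix A" "\<And>i. symmetric_matrix (B i)" "\<And>j. j < m \<Longrightarrow> symmetric_matrix (C j)"
    and feas: "strictly_feasible A B m C"
    and nonneg: "\<And>x. x \<in> proj_spectrahedron A B m C \<Longrightarrow> 0 \<le> c + b \<bullet> x"
  obtains W s where "pos_semidef W" "0 \<le> s" "W \<bullet> A + s = c" "\<And>i. W \<bullet> B i = b $ i"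
    "\<And>j. j < m \<Longrightarrow> W \<bullet> C j = 0"
proof -
  let ?F = "\<lambda>t. lin_matrix (t *\<^sub>R A) B m C"
  define P where "P = {M :: real ^ 'k ^ 'k. \<forall>v. 0 \<le> v \<bullet> (M *v v)}"
  \<comment> \<open>If 0 were in \<open>T\<close>, a point of the homogenized feasible cone would
    have objective \<open>- r\<close>, and \<open>r > 0\<close> contradicts
    \<open>homogenized_nonneg\<close>.\<close>
  define T where "T = {(?F t x y - M, t - s, t * c + b \<bullet> x + r) |t x y M s r. M \<in> P \<and> 0 \<le> s \<and> 0 < r}"
  have P_cone: "u *\<^sub>R M + v *\<^sub>R M' \<in> P" if "M \<in> P" "M' \<in> P" "0 \<le> u" "0 \<le> v" for M M' u v
    using that by (simp add: P_def matrix_vector_mult_add_rdistrib inner_add_right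
        scaleR_matrix_vector_assoc[symmetric])
  have "0 \<in> P" by (simp add: P_def)
  have "convex T"
  proof (rule convexI)
    fix p q and u v :: real
    assume "p \<in> T" "q \<in> T" and uv: "0 \<le> u" "0 \<le> v" "u + v = 1"
    then obtain t x y M s r t' x' y' M' s' r' where
      pq: "p = (?F t x y - M, t - s, t * c + b \<bullet> x + r)" "q = (?F t' x' y' - M', t' - s', t' * c + b \<bullet> x' + r')"
      and M: "M \<in> P" "M' \<in> P" and s: "0 \<le> s" "0 \<le> s'" and r: "0 < r" "0 < r'"
      unfolding T_def by blast
    have "u *\<^sub>R p + v *\<^sub>R q =
      (?F (u * t + v * t') (u *\<^sub>R x + v *\<^sub>R x') (\<lambda>j. u * y j + v * y' j) - (u *\<^sub>R M + v *\<^sub>R M'),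
       (u * t + v * t') - (u * s + v * s'),
       (u * t + v * t') * c + b \<bullet> (u *\<^sub>R x + v *\<^sub>R x') + (u * r + v * r'))"
      unfolding pq lin_matrix_combine by (simp add: algebra_simps inner_add_right)
    moreover have "0 < u * r + v * r'"
    proof (cases "u = 0")
      case False
      then show ?thesis using uv r by (intro add_pos_nonneg) auto
    qed (use uv r in auto)
    ultimately show "u *\<^sub>R p + v *\<^sub>R q \<in> T"
      unfolding T_def using P_cone[OF M uv(1,2)] uv s by fastforce
  qed
  moreover have "0 \<notin> T"
  proof
    assume "0 \<in> T"
    then obtain t x y M s r where *: "?F t x y = M" "t = s" "t * c + b \<bullet> x + r = 0"
      "M \<in> P" "0 \<le> s" "0 < r"
      by (auto simp: T_def zero_prod_def)
    then have "0 \<le> t * c + b \<bullet> x"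
      by (intro homogenized_nonneg[OF sym feas nonneg, of t x y]) (auto simp: P_def)
    with * show False by simp
  qed
  ultimately obtain a where a: "a \<noteq> 0" "\<forall>p\<in>T. 0 \<le> a \<bullet> p"
    using separating_hyperplane_set_0 by blast
  obtain V z \<rho> where a_eq: "a = (V, z, \<rho>)" by (cases a)
  define G where "G t x y = V \<bullet> ?F t x y + z * t + \<rho> * (t * c + b \<bullet> x)" for t x y
  have sep: "0 \<le> G t x y - V \<bullet> M - z * s + \<rho> * r" if "M \<in> P" "0 \<le> s" "0 < r" for t x y M s r
  proof -
    have "(?F t x y - M, t - s, t * c + b \<bullet> x + r) \<in> T" unfolding T_def using that by blast
    then have "0 \<le> a \<bullet> (?F t x y - M, t - s, t * c + b \<bullet> x + r)" using a(2) by blast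
    then show ?thesis by (simp add: a_eq G_def inner_diff_right algebra_simps)
  qed
  have G_scale: "G (l * t) (l *\<^sub>R x) (\<lambda>j. l * y j) = l * G t x y" for l t x y
    unfolding G_def lin_matrix_scale by (simp add: algebra_simps)
  have G_nonneg: "0 \<le> G t x y" for t x y
  proof (rule nonneg_slope)
    show "0 \<le> l * G t x y + \<rho>" for l
      using sep[OF \<open>0 \<in> P\<close>, of 0 1 "l * t" "l *\<^sub>R x" "\<lambda>j. l * y j"] unfolding G_scale by simp
  qed
  \<comment> \<open>\<open>G\<close> is linear in \<open>(t, x, y)\<close>, so nonnegativity at a
    point and at its negative makes it vanish.\<close>
  have G_0: "G t x y = 0" for t x y
    using G_nonneg[of t x y] G_nonneg[of "- 1 * t" "- 1 *\<^sub>R x" "\<lambda>j. - 1 * y j"]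
    unfolding G_scale by simp
  have V_nonpos: "0 \<le> - (V \<bullet> M)" if "M \<in> P" for M
  proof (rule nonneg_slope)
    fix l :: real assume "0 \<le> l"
    then have "l *\<^sub>R M \<in> P" using P_cone[OF that \<open>0 \<in> P\<close>, of l 0] by simp
    from sep[OF this, of 0 1] show "0 \<le> l * - (V \<bullet> M) + \<rho>" by (simp add: G_0)
  qed
  have z_nonpos: "0 \<le> - z"
  proof (rule nonneg_slope)
    show "0 \<le> l * - z + \<rho>" if "0 \<le> l" for l
      using sep[OF \<open>0 \<in> P\<close> that, of 1] by (simp add: G_0 mult.commute)
  qed
  have "0 \<le> \<rho>" using sep[OF \<open>0 \<in> P\<close>, of 0 1] by (simp add: G_0)
  \<comment> \<open>If \<rho> were 0, \<open>V\<close> would be orthogonal to the positive definite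
    \<open>?L\<close> and \<open>z\<close> would be 0. Moving from \<open>?L\<close> a little in
    direction \<open>V\<close> stays in \<open>P\<close>, where pairing with \<open>V\<close> is at
    most 0; hence \<open>V = 0\<close>, against \<open>a \<noteq> 0\<close>.\<close>
  moreover have "\<rho> \<noteq> 0"
  proof
    assume "\<rho> = 0"
    obtain x0 y0 where L0: "pos_def (lin_matrix A B m C x0 y0)" (is "pos_def ?L")
      using feas by (auto simp: strictly_feasible_def)
    have "0 \<le> v \<bullet> (?L *v v)" for v
      using L0 by (cases "v = 0") (auto simp: pos_def_def less_imp_le)
    then have "?L \<in> P" by (simp add: P_def)
    then have "0 \<le> - (V \<bullet> ?L)" by (rule V_nonpos)
    moreover have "V \<bullet> ?L + z = 0" using G_0[of 1 x0 y0] \<open>\<rho> = 0\<close> by (simp add: G_def)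
    ultimately have "V \<bullet> ?L = 0" "z = 0" using z_nonpos by auto
    obtain \<epsilon> where \<epsilon>: "0 < \<epsilon>" "\<And>v. 0 \<le> v \<bullet> ((?L + \<epsilon> *\<^sub>R V) *v v)"
      using pos_def_perturb[OF L0] by blast
    then have "0 \<le> - (V \<bullet> (?L + \<epsilon> *\<^sub>R V))" by (intro V_nonpos) (simp add: P_def)
    then have "\<epsilon> * (V \<bullet> V) \<le> 0" using \<open>V \<bullet> ?L = 0\<close> by (simp add: inner_add_right)
    then have "V \<bullet> V \<le> 0" using \<epsilon>(1) by (simp add: mult_le_0_iff)
    then have "V = 0" by (metis inner_gt_zero_iff not_le)
    then show False using a(1) \<open>z = 0\<close> \<open>\<rho> = 0\<close> by (simp add: a_eq zero_prod_def)
  qed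
  ultimately have \<rho>: "0 < \<rho>" by simp
  define W where "W = (- 1 / \<rho>) *\<^sub>R V"
  \<comment> \<open>This identity holds for all \<open>(t, x, y)\<close>, so unit choices of the
    arguments read off each dual equation.\<close>
  have WG: "W \<bullet> ?F t x y + (- z / \<rho>) * t = t * c + b \<bullet> x" for t x y
  proof -
    have "(- 1 / \<rho>) * f + (- z / \<rho>) * t = k" if "f + z * t + \<rho> * k = 0" for f k
      using that \<rho> by (simp add: field_simps)
    from this[OF G_0[of t x y, unfolded G_def]] show ?thesis by (simp add: W_def)
  qed
  show thesis
  proof
    show "pos_semidef W"
    proof (rule dual_cone_pos_semidef)
      fix M :: "real ^ 'k ^ 'k" assume "\<And>v. 0 \<le> v \<bullet> (M *v v)"
      then show "0 \<le> W \<bullet> M"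
        using V_nonpos[of M] \<rho> by (simp add: W_def P_def divide_nonpos_pos)
    qed
    show "0 \<le> - z / \<rho>" using z_nonpos \<rho> by (intro divide_nonneg_pos)
    show "W \<bullet> A + - z / \<rho> = c" using WG[of 1 0 "\<lambda>_. 0"] by (simp add: lin_matrix_def)
    show "W \<bullet> B i = b $ i" for i
    proof -
      have "(\<Sum>k\<in>UNIV. axis i (1::real) $ k *\<^sub>R B k) = B i"
        by (simp add: axis_def if_distrib[of "\<lambda>a. a *\<^sub>R _"] cong: if_cong)
      then show ?thesis
        using WG[of 0 "axis i 1" "\<lambda>_. 0"] by (simp add: lin_matrix_def inner_axis)
    qed
    show "W \<bullet> C j = 0" if "j < m" for j
    proof -
      have "(\<Sum>k<m. (if k = j then 1 else 0) *\<^sub>R C k) = C j"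
        using that by (simp add: if_distrib[of "\<lambda>a. a *\<^sub>R _"] cong: if_cong)
      then show ?thesis
        using WG[of 0 0 "\<lambda>k. if k = j then 1 else 0"] by (simp add: lin_matrix_def)
    qed
  qed
qed

subsection \<open>The quadratic module of a linear matrix polynomial\<close>

lemma QM_memI:
  fixes N :: nat and q :: "nat \<Rightarrow> 'n::finite rpoly ^ 'k"
  assumes "\<And>i. i < m \<Longrightarrow> (\<Sum>j<N. qform (const_matrix (C i)) (q j)) = 0" "\<sigma> \<in> sums_of_squares"
  shows "(\<Sum>j<N. qform (lin_poly_matrix A B) (q j)) + \<sigma> \<in> QM A B m C"
  using assms unfolding QM_def by blast

lemma QM_memE:
  fixes p :: "'n::finite rpoly"
  assumes "p \<in> QM A B m C"
  obtains N :: nat and q \<sigma> where "p = (\<Sum>j<N. qform (lin_poly_matrix A B) (q j)) + \<sigma>"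
    "\<And>i. i < m \<Longrightarrow> (\<Sum>j<N. qform (const_matrix (C i)) (q j)) = 0" "\<sigma> \<in> sums_of_squares"
  using assms unfolding QM_def by blast

lemma qform_eq_sum: "qform M q = (\<Sum>r\<in>UNIV. \<Sum>s\<in>UNIV. q $ r * (M $ r $ s * q $ s))"
  by (simp add: qform_def matrix_vector_mult_def sum_distrib_left)

lemma qform_scale: "qform M (h *s q) = h\<^sup>2 * qform M q"
  by (simp add: qform_eq_sum power2_eq_square sum_distrib_left ac_simps)

lemma qform_add: "qform (M + M') q = qform M q + qform M' q"
  by (simp add: qform_eq_sum distrib_left distrib_right sum.distrib)

lemma qform_0: "qform 0 q = 0"
  by (simp add: qform_eq_sum)

lemma qform_sum: "qform (\<Sum>i\<in>I. M i) q = (\<Sum>i\<in>I. qform (M i) q)"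
  by (induction I rule: infinite_finite_induct) (simp_all add: qform_add qform_0)

lemma qform_mult: "qform (\<chi> r s. h * M $ r $ s) q = h * qform M q"
  by (simp add: qform_eq_sum sum_distrib_left ac_simps)

lemma qform_const: "qform (const_matrix M) (\<chi> r. pconst (w $ r)) = pconst (outer w \<bullet> M)"
  by (simp add: qform_eq_sum const_matrix_def outer_def inner_vec_def pconst_sum pconst_mult ac_simps)

lemma qform_lin_poly_const:
  "qform (lin_poly_matrix A B) (\<chi> r. pconst (w $ r))
    = pconst (outer w \<bullet> A) + (\<Sum>i\<in>UNIV. pconst (outer w \<bullet> B i) * pvar i)"
  by (simp add: lin_poly_matrix_def qform_add qform_sum qform_mult qform_const mult.commute)

lemma peval_qform:
  fixes M :: "'n::finite rpoly ^ 'k ^ 'k"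
  shows "peval (qform M q) x
    = (\<chi> r. peval (q $ r) x) \<bullet> ((\<chi> r s. peval (M $ r $ s) x) *v (\<chi> r. peval (q $ r) x))"
  by (simp add: qform_eq_sum inner_vec_def matrix_vector_mult_def sum_distrib_left)

lemma peval_const_matrix: "(\<chi> r s. peval (const_matrix M $ r $ s) x) = M"
  by (simp add: const_matrix_def vec_eq_iff)

lemma peval_lin_poly_matrix:
  "(\<chi> r s. peval (lin_poly_matrix A B $ r $ s) x) = A + (\<Sum>i\<in>UNIV. (x $ i) *\<^sub>R B i)"
  by (simp add: lin_poly_matrix_def const_matrix_def vec_eq_iff)

text \<open>Concatenating families adds their side conditions; replacing each \<open>q j\<close> by
  \<open>h *s q j\<close> multiplies these conditions by the square of \<open>h\<close>.\<close>

lemma quadratic_module_QM: "quadratic_module (QM A B m C)"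
  unfolding quadratic_module_def
proof (intro conjI ballI allI)
  show "1 \<in> QM A B m C"
    using QM_memI[where N = 0 and \<sigma> = 1] by simp
next
  fix f g assume "f \<in> QM A B m C" "g \<in> QM A B m C"
  then obtain N K :: nat and q p \<sigma> \<tau> where
    f: "f = (\<Sum>j<N. qform (lin_poly_matrix A B) (q j)) + \<sigma>"
      "\<And>i. i < m \<Longrightarrow> (\<Sum>j<N. qform (const_matrix (C i)) (q j)) = 0" "\<sigma> \<in> sums_of_squares" and
    g: "g = (\<Sum>j<K. qform (lin_poly_matrix A B) (p j)) + \<tau>"
      "\<And>i. i < m \<Longrightarrow> (\<Sum>j<K. qform (const_matrix (C i)) (p j)) = 0" "\<tau> \<in> sums_of_squares"
    by (elim QM_memE) blast
  let ?q = "\<lambda>j. if j < N then q j else p (j - N)"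
  have "f + g = (\<Sum>j<N + K. qform (lin_poly_matrix A B) (?q j)) + (\<sigma> + \<tau>)"
    unfolding f(1) g(1) sum_lessThan_append[symmetric] by (simp add: ac_simps)
  also have "\<dots> \<in> QM A B m C"
    using f(2,3) g(2,3)
    by (intro QM_memI sos_add) (simp_all flip: sum_lessThan_append)
  finally show "f + g \<in> QM A B m C" .
next
  fix f h assume "f \<in> QM A B m C"
  then obtain N :: nat and q \<sigma> where
    f: "f = (\<Sum>j<N. qform (lin_poly_matrix A B) (q j)) + \<sigma>"
      "\<And>i. i < m \<Longrightarrow> (\<Sum>j<N. qform (const_matrix (C i)) (q j)) = 0" "\<sigma> \<in> sums_of_squares"
    by (elim QM_memE) blast
  have "h\<^sup>2 * f = (\<Sum>j<N. qform (lin_poly_matrix A B) (h *s q j)) + h\<^sup>2 * \<sigma>"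
    unfolding f(1) by (simp add: qform_scale distrib_left sum_distrib_left)
  also have "\<dots> \<in> QM A B m C"
    using f(2,3) by (intro QM_memI sos_square_mult) (simp_all add: qform_scale flip: sum_distrib_left)
  finally show "h\<^sup>2 * f \<in> QM A B m C" .
qed

text \<open>Adding \<open>y\<^sub>i\<close> times the vanishing sums \<open>\<Sum>\<^sub>j q\<^sub>j\<^sup>t C\<^sub>i q\<^sub>j\<close> turns \<open>\<A>'(x)\<close> into \<open>\<A>(x, y)\<close>.\<close>

lemma QM_nonneg:
  fixes B :: "'n::finite \<Rightarrow> real ^ 'k ^ 'k"
  assumes p: "p \<in> QM A B m C" and x: "x \<in> proj_spectrahedron A B m C"
  shows "0 \<le> peval p x"
proof -
  obtain N :: nat and q \<sigma> where
    p: "p = (\<Sum>j<N. qform (lin_poly_matrix A B) (q j)) + \<sigma>"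
      and C: "\<And>i. i < m \<Longrightarrow> (\<Sum>j<N. qform (const_matrix (C i)) (q j)) = 0"
      and \<sigma>: "\<sigma> \<in> sums_of_squares"
    using p by (elim QM_memE) blast
  obtain y where y: "pos_semidef (lin_matrix A B m C x y)"
    using x by (auto simp: proj_spectrahedron_def)
  define v where "v j = (\<chi> r. peval (q j $ r) x)" for j
  have C0: "(\<Sum>j<N. outer (v j)) \<bullet> C i = 0" if "i < m" for i
  proof -
    have "peval (\<Sum>j<N. qform (const_matrix (C i)) (q j)) x = 0" using C[OF that] by simp
    then show ?thesis
      by (simp add: peval_qform peval_const_matrix inner_sum_left inner_outer v_def)
  qed
  have "peval p x = (\<Sum>j<N. outer (v j)) \<bullet> (A + (\<Sum>i\<in>UNIV. (x $ i) *\<^sub>R B i)) + peval \<sigma> x"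
    unfolding p
    by (simp add: peval_qform peval_lin_poly_matrix inner_outer v_def
        inner_sum_left[of _ _ "A + _"] del: inner_add_right)
  also have "(\<Sum>j<N. outer (v j)) \<bullet> (A + (\<Sum>i\<in>UNIV. (x $ i) *\<^sub>R B i))
      = (\<Sum>j<N. outer (v j)) \<bullet> lin_matrix A B m C x y"
    by (simp add: lin_matrix_def inner_add_right inner_sum_right[of _ _ "{..<m}"] C0)
  also have "\<dots> = (\<Sum>j<N. v j \<bullet> (lin_matrix A B m C x y *v v j))"
    by (simp add: inner_sum_left inner_outer)
  finally have "peval p x = (\<Sum>j<N. v j \<bullet> (lin_matrix A B m C x y *v v j)) + peval \<sigma> x" .
  moreover have "0 \<le> (\<Sum>j<N. v j \<bullet> (lin_matrix A B m C x y *v v j))"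
    using y by (intro sum_nonneg) (simp add: pos_semidef_def)
  ultimately show ?thesis using peval_sos_nonneg[OF \<sigma>, of x] by simp
qed

text \<open>The rank-one terms of the dual multiplier \<open>W\<close> provide constant vectors.
  Orthogonality of \<open>W\<close> to each \<open>C j\<close> is the side condition of
  \<open>QM\<close>, and the slack \<open>s\<close> becomes the sum of squares.\<close>

lemma affine_mem_QM:
  fixes A :: "real ^ 'k ^ 'k" and B :: "'n::finite \<Rightarrow> real ^ 'k ^ 'k" and C :: "nat \<Rightarrow> real ^ 'k ^ 'k"
  assumes sym: "symmetric_matrix A" "\<And>i. symmetric_matrix (B i)" "\<And>j. j < m \<Longrightarrow> symmetric_matrix (C j)"
    and feas: "strictly_feasible A B m C"
    and nonneg: "\<And>x. x \<in> proj_spectrahedron A B m C \<Longrightarrow> 0 \<le> c + b \<bullet> x"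
  shows "pconst c + (\<Sum>i\<in>UNIV. pconst (b $ i) * pvar i) \<in> QM A B m C"
proof -
  obtain W s where W: "pos_semidef W" "0 \<le> s" "W \<bullet> A + s = c" "\<And>i. W \<bullet> B i = b $ i"
    "\<And>j. j < m \<Longrightarrow> W \<bullet> C j = 0"
    using lin_matrix_duality[OF sym feas nonneg] by blast
  obtain N :: nat and w where w: "W = (\<Sum>j<N. outer (w j))"
    using pos_semidef_sum_outer[OF W(1)] by blast
  let ?q = "\<lambda>j. \<chi> r. pconst (w j $ r)"
  have sum_outer: "(\<Sum>j<N. pconst (outer (w j) \<bullet> M)) = pconst (W \<bullet> M)" for M
    by (simp add: w inner_sum_left pconst_sum)
  have "(\<Sum>j<N. \<Sum>i\<in>UNIV. pconst (outer (w j) \<bullet> B i) * pvar i)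
      = (\<Sum>i\<in>UNIV. pconst (b $ i) * pvar i)"
    by (subst sum.swap) (simp add: sum_outer W(4) flip: sum_distrib_right)
  then have "pconst c + (\<Sum>i\<in>UNIV. pconst (b $ i) * pvar i)
      = (\<Sum>j<N. qform (lin_poly_matrix A B) (?q j)) + pconst s"
    by (simp add: qform_lin_poly_const sum.distrib sum_outer pconst_add flip: W(3))
  also have "\<dots> \<in> QM A B m C"
    by (intro QM_memI sos_pconst W(2)) (simp add: qform_const sum_outer W(5))
  finally show ?thesis .
qed

section \<open>The nonnegativity set and the bounded case\<close>

lemma convex_proj_spectrahedron: "convex (proj_spectrahedron A B m C)"
proof (rule convexI)
  fix x x' and u v :: real
  assume "x \<in> proj_spectrahedron A B m C" "x' \<in> proj_spectrahedron A B m C"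
    and uv: "0 \<le> u" "0 \<le> v" "u + v = 1"
  then obtain y y' where y: "pos_semidef (lin_matrix A B m C x y)" "pos_semidef (lin_matrix A B m C x' y')"
    by (auto simp: proj_spectrahedron_def)
  have "lin_matrix A B m C (u *\<^sub>R x + v *\<^sub>R x') (\<lambda>j. u * y j + v * y' j)
      = u *\<^sub>R lin_matrix A B m C x y + v *\<^sub>R lin_matrix A B m C x' y'"
    using lin_matrix_combine[of u 1 v 1 A B m C x x' y y'] uv(3) by simp
  moreover have "pos_semidef \<dots>"
    using y uv by (simp add: pos_semidef_def symmetric_matrix_add symmetric_matrix_scaleR
        matrix_vector_mult_add_rdistrib inner_add_right scaleR_matrix_vector_assoc[symmetric])
  ultimately have "pos_semidef (lin_matrix A B m C (u *\<^sub>R x + v *\<^sub>R x') (\<lambda>j. u * y j + v * y' j))"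
    by simp
  then show "u *\<^sub>R x + v *\<^sub>R x' \<in> proj_spectrahedron A B m C"
    unfolding proj_spectrahedron_def by blast
qed

lemma QM_nonneg_set_eq_closure:
  fixes A :: "real ^ 'k ^ 'k" and B :: "'n::finite \<Rightarrow> real ^ 'k ^ 'k" and C :: "nat \<Rightarrow> real ^ 'k ^ 'k"
  assumes sym: "symmetric_matrix A" "\<And>i. symmetric_matrix (B i)" "\<And>j. j < m \<Longrightarrow> symmetric_matrix (C j)"
    and feas: "strictly_feasible A B m C"
  shows "{x. \<forall>p\<in>QM A B m C. 0 \<le> peval p x} = closure (proj_spectrahedron A B m C)"
proof
  let ?S = "proj_spectrahedron A B m C"
  have "closed (\<Inter>p\<in>QM A B m C. {x. 0 \<le> peval p x})"
    by (intro closed_INT ballI closed_Collect_le continuous_intros continuous_on_peval)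
  moreover have "(\<Inter>p\<in>QM A B m C. {x. 0 \<le> peval p x}) = {x. \<forall>p\<in>QM A B m C. 0 \<le> peval p x}"
    by auto
  ultimately show "closure ?S \<subseteq> {x. \<forall>p\<in>QM A B m C. 0 \<le> peval p x}"
    using QM_nonneg by (intro closure_minimal) auto
  show "{x. \<forall>p\<in>QM A B m C. 0 \<le> peval p x} \<subseteq> closure ?S"
  proof (rule subsetI, rule ccontr)
    fix x assume x: "x \<in> {x. \<forall>p\<in>QM A B m C. 0 \<le> peval p x}" and "x \<notin> closure ?S"
    then obtain b c where b: "b \<bullet> x < c" "\<And>z. z \<in> closure ?S \<Longrightarrow> c < b \<bullet> z"
      using separating_hyperplane_closed_point[of "closure ?S" x]
        convex_closure[OF convex_proj_spectrahedron] by blast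
    \<comment> \<open>The separating affine function is positive on the closure, so it lies in
      \<open>QM\<close>, yet it is negative at \<open>x\<close>.\<close>
    have "pconst (- c) + (\<Sum>i\<in>UNIV. pconst (b $ i) * pvar i) \<in> QM A B m C"
    proof (rule affine_mem_QM[OF sym feas])
      show "0 \<le> - c + b \<bullet> z" if "z \<in> ?S" for z
        using b(2)[of z] closure_subset[of ?S] that by auto
    qed
    then have "0 \<le> peval (pconst (- c) + (\<Sum>i\<in>UNIV. pconst (b $ i) * pvar i)) x"
      using x by blast
    also have "\<dots> = - c + b \<bullet> x" by (simp add: inner_vec_def)
    finally show False using b(1) by simp
  qed
qed

lemma archimedean_QM:
  fixes A :: "real ^ 'k ^ 'k" and B :: "'n::finite \<Rightarrow> real ^ 'k ^ 'k" and C :: "nat \<Rightarrow> real ^ 'k ^ 'k"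
  assumes sym: "symmetric_matrix A" "\<And>i. symmetric_matrix (B i)" "\<And>j. j < m \<Longrightarrow> symmetric_matrix (C j)"
    and feas: "strictly_feasible A B m C"
    and bdd: "bounded (proj_spectrahedron A B m C)"
  shows "archimedean_qm (QM A B m C)"
proof (rule archimedean_qm_generators[OF quadratic_module_QM])
  obtain R where R: "0 < R" "\<And>x. x \<in> proj_spectrahedron A B m C \<Longrightarrow> norm x \<le> R"
    using bdd by (auto simp: bounded_pos)
  have coord: "\<bar>x $ i\<bar> \<le> R" if "x \<in> proj_spectrahedron A B m C" for x i
    using component_le_norm_cart[of x i] R(2)[OF that] by simp
  \<comment> \<open>The values \<open>a = 1\<close> and \<open>a = - 1\<close> give both coordinate
    bounds at once.\<close>
  have mem: "pconst R + pconst a * pvar i \<in> QM A B m C" if "\<bar>a\<bar> = 1" for a i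
  proof -
    have "pconst R + (\<Sum>k\<in>UNIV. pconst (axis i a $ k) * pvar k) \<in> QM A B m C"
    proof (rule affine_mem_QM[OF sym feas])
      fix x assume "x \<in> proj_spectrahedron A B m C"
      then have "\<bar>a * x $ i\<bar> \<le> R" using coord that by (simp add: abs_mult)
      then show "0 \<le> R + axis i a \<bullet> x" by (simp add: inner_axis')
    qed
    also have "(\<Sum>k\<in>UNIV. pconst (axis i a $ k) * pvar k) = (\<Sum>k\<in>UNIV. if k = i then pconst a * pvar k else 0)"
      by (rule sum.cong) (auto simp: axis_def)
    finally show ?thesis by simp
  qed
  show "\<exists>c>0. pconst c - pvar i \<in> QM A B m C \<and> pconst c + pvar i \<in> QM A B m C" for i
    using R(1) mem[of 1 i] mem[of "- 1" i] by (auto simp: pconst_minus)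
qed

theorem theorem5p1:
  fixes A :: "real ^ 'k ^ 'k"
    and B :: "'n::finite \<Rightarrow> real ^ 'k ^ 'k"
    and m :: nat
    and C :: "nat \<Rightarrow> real ^ 'k ^ 'k"
  assumes "symmetric_matrix A"
    and "\<And>i. symmetric_matrix (B i)"
    and "\<And>j. j < m \<Longrightarrow> symmetric_matrix (C j)"
    and "strictly_feasible A B m C"
  shows "(\<forall>p\<in>QM A B m C. \<forall>x\<in>proj_spectrahedron A B m C. 0 \<le> peval p x)
    \<and> {x. \<forall>p\<in>QM A B m C. 0 \<le> peval p x} = closure (proj_spectrahedron A B m C)
    \<and> (bounded (proj_spectrahedron A B m C) \<longrightarrow>
         archimedean_qm (QM A B m C)
         \<and> (\<forall>p. (\<forall>x\<in>closure (proj_spectrahedron A B m C). 0 < peval p x) \<longrightarrow> p \<in> QM A B m C))"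
proof (intro conjI ballI impI allI)
  show set_eq: "{x. \<forall>p\<in>QM A B m C. 0 \<le> peval p x} = closure (proj_spectrahedron A B m C)"
    by (rule QM_nonneg_set_eq_closure[OF assms])
  assume "bounded (proj_spectrahedron A B m C)"
  then show arch: "archimedean_qm (QM A B m C)"
    by (intro archimedean_QM assms)
  fix p assume "\<forall>x\<in>closure (proj_spectrahedron A B m C). 0 < peval p x"
  \<comment> \<open>By \<open>set_eq\<close>, the points where all of \<open>QM\<close> is
    nonnegative are those where \<open>p\<close> is assumed positive.\<close>
  then show "p \<in> QM A B m C"
    using archimedean_positivstellensatz[OF arch] set_eq by blast
qed (rule QM_nonneg)

end
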